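(* Let $L$ be a locally compact Hausdorff space and let $(e^{tA})_{t\ge 0}$ be a real, individually eventually positive, and persistently irreducible $C_0$-semigroup on $C_0(L)$. Then the spectrum $\sigma(A)$ is non-empty.
   Context: $C_0(L)$ is the Banach lattice of continuous (real- or complex-valued) functions on $L$ that vanish at infinity, with the supremum norm and the pointwise order. $A$ denotes the generator of the $C_0$-semigroup $(e^{tA})_{t\ge 0}$, and $\sigma(A)$ its spectrum. Let $E$ be a Banach lattice. A $C_0$-semigroup $(e^{tA})_{t\ge 0}$ on $E$ is called real if each operator $e^{tA}$ maps the real part $E_{\mathbb R}$ of $E$ into itself. It is called individually eventually positive if for each $0\le f\in E$ there exists $t_0\ge 0$ such that $e^{tA}f\ge 0$ for all $t\ge t_0$. It is called persistently irreducible if the only closed ideals $I$ of $E$ that are uniformly eventually invariant, i.e., for which there exists $t_0\ge 0$ with $e^{tA}I\subseteq I$ for all $t\ge t_0$, are $\{0\}$ and $E$. *)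

theory Defs
  imports "HOL-Analysis.Analysis"
begin

section \<open>The space of continuous functions vanishing at infinity\<close>

text \<open>Realised inside the type of bounded continuous functions (a continuous function vanishing at
  infinity is automatically bounded), whose norm is the supremum norm. The scalars
  \<open>'k\<close> are meant to be \<^typ>\<open>real\<close> or \<^typ>\<open>complex\<close>. Note that
  types are non-empty, so \<open>L\<close>, rendered as a type \<open>'a\<close>, is non-empty; for empty
  \<open>L\<close> the space is zero and every spectrum is empty.\<close>

definition vanishes_at_infinity :: "('a::topological_space \<Rightarrow> 'k::real_normed_vector) \<Rightarrow> bool" where
  "vanishes_at_infinity f \<longleftrightarrow> (\<forall>e>0. \<exists>K. compact K \<and> (\<forall>x. x \<notin> K \<longrightarrow> norm (f x) < e))"

lemma vanishes_at_infinity_zero: "vanishes_at_infinity (\<lambda>x. 0)"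
  unfolding vanishes_at_infinity_def by (auto intro: exI[of _ "{}"])

lemma vanishes_at_infinity_add:
  assumes "vanishes_at_infinity f" "vanishes_at_infinity g"
  shows "vanishes_at_infinity (\<lambda>x. f x + g x)"
  unfolding vanishes_at_infinity_def
proof (intro allI impI)
  fix e :: real
  assume "e > 0"
  then have "e / 2 > 0" by simp
  obtain K where K: "compact K" "\<And>x. x \<notin> K \<Longrightarrow> norm (f x) < e / 2"
    using assms(1) \<open>e / 2 > 0\<close> unfolding vanishes_at_infinity_def by blast
  obtain K' where K': "compact K'" "\<And>x. x \<notin> K' \<Longrightarrow> norm (g x) < e / 2"
    using assms(2) \<open>e / 2 > 0\<close> unfolding vanishes_at_infinity_def by blast
  have "norm (f x + g x) < e" if "x \<notin> K \<union> K'" for x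
    using norm_triangle_ineq[of "f x" "g x"] K(2)[of x] K'(2)[of x] that by auto
  then show "\<exists>K. compact K \<and> (\<forall>x. x \<notin> K \<longrightarrow> norm (f x + g x) < e)"
    using K(1) K'(1) by (intro exI[of _ "K \<union> K'"]) (auto intro: compact_Un)
qed

lemma vanishes_at_infinity_dominated:
  assumes "vanishes_at_infinity f" and "\<And>x. norm (g x) \<le> c * norm (f x)"
  shows "vanishes_at_infinity g"
  unfolding vanishes_at_infinity_def
proof (intro allI impI)
  fix e :: real
  assume "e > 0"
  define d where "d = e / (\<bar>c\<bar> + 1)"
  have "d > 0" using \<open>e > 0\<close> unfolding d_def by auto
  then obtain K where K: "compact K" "\<And>x. x \<notin> K \<Longrightarrow> norm (f x) < d"
    using assms(1) unfolding vanishes_at_infinity_def by blast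
  have "norm (g x) < e" if "x \<notin> K" for x
  proof -
    have "norm (g x) \<le> (\<bar>c\<bar> + 1) * norm (f x)"
      using assms(2)[of x] by (rule order_trans) (intro mult_right_mono, auto)
    also have "\<dots> < (\<bar>c\<bar> + 1) * d"
      using K(2)[OF that] by (intro mult_strict_left_mono) auto
    also have "\<dots> = e" unfolding d_def by auto
    finally show ?thesis .
  qed
  then show "\<exists>K. compact K \<and> (\<forall>x. x \<notin> K \<longrightarrow> norm (g x) < e)"
    using K(1) by blast
qed

typedef (overloaded) ('a, 'k) c0 =
  "{f :: 'a::topological_space \<Rightarrow>\<^sub>C 'k::real_normed_vector. vanishes_at_infinity (apply_bcontfun f)}"
  morphisms bcontfun_of_c0 Abs_c0
  by (auto intro!: exI[of _ 0] vanishes_at_infinity_zero)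

setup_lifting type_definition_c0

definition apply_c0 :: "('a::topological_space, 'k::real_normed_vector) c0 \<Rightarrow> 'a \<Rightarrow> 'k" where
  "apply_c0 f = apply_bcontfun (bcontfun_of_c0 f)"

lemma c0_eqI: "(\<And>x. apply_c0 f x = apply_c0 g x) \<Longrightarrow> f = g"
  by (metis apply_c0_def bcontfun_eqI bcontfun_of_c0_inject)

instantiation c0 :: (topological_space, real_normed_vector) real_vector
begin

lift_definition zero_c0 :: "('a, 'b) c0" is 0
  by (simp add: vanishes_at_infinity_zero)

lift_definition plus_c0 :: "('a, 'b) c0 \<Rightarrow> ('a, 'b) c0 \<Rightarrow> ('a, 'b) c0" is "(+)"
  by (simp add: vanishes_at_infinity_add)

lift_definition uminus_c0 :: "('a, 'b) c0 \<Rightarrow> ('a, 'b) c0" is uminus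
  by (erule vanishes_at_infinity_dominated[where c = 1]) simp

lift_definition minus_c0 :: "('a, 'b) c0 \<Rightarrow> ('a, 'b) c0 \<Rightarrow> ('a, 'b) c0" is "(-)"
proof -
  fix f g :: "'a \<Rightarrow>\<^sub>C 'b"
  assume f: "vanishes_at_infinity f" and g: "vanishes_at_infinity g"
  have "vanishes_at_infinity (\<lambda>x. - g x)"
    by (rule vanishes_at_infinity_dominated[OF g, where c = 1]) simp
  from vanishes_at_infinity_add[OF f this] show "vanishes_at_infinity (f - g)" by simp
qed

lift_definition scaleR_c0 :: "real \<Rightarrow> ('a, 'b) c0 \<Rightarrow> ('a, 'b) c0" is scaleR
  subgoal for r f by (erule vanishes_at_infinity_dominated[where c = "\<bar>r\<bar>"]) simp
  done

instance
proof
  show "x + y + z = x + (y + z)" for x y z :: "('a, 'b) c0" by transfer (rule add.assoc)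
  show "x + y = y + x" for x y :: "('a, 'b) c0" by transfer (rule add.commute)
  show "0 + x = x" for x :: "('a, 'b) c0" by transfer simp
  show "- x + x = 0" for x :: "('a, 'b) c0" by transfer simp
  show "x - y = x + - y" for x y :: "('a, 'b) c0" by transfer simp
  show "a *\<^sub>R (x + y) = a *\<^sub>R x + a *\<^sub>R y" for a and x y :: "('a, 'b) c0"
    by transfer (rule scaleR_add_right)
  show "(a + b) *\<^sub>R x = a *\<^sub>R x + b *\<^sub>R x" for a b and x :: "('a, 'b) c0"
    by transfer (rule scaleR_add_left)
  show "a *\<^sub>R b *\<^sub>R x = (a * b) *\<^sub>R x" for a b and x :: "('a, 'b) c0" by transfer simp
  show "1 *\<^sub>R x = x" for x :: "('a, 'b) c0" by transfer simp
qed

end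

instantiation c0 :: (topological_space, real_normed_vector) real_normed_vector
begin

lift_definition norm_c0 :: "('a, 'b) c0 \<Rightarrow> real" is norm .

lift_definition dist_c0 :: "('a, 'b) c0 \<Rightarrow> ('a, 'b) c0 \<Rightarrow> real" is dist .

definition sgn_c0 :: "('a, 'b) c0 \<Rightarrow> ('a, 'b) c0" where
  "sgn_c0 f = f /\<^sub>R norm f"

definition uniformity_c0 :: "(('a, 'b) c0 \<times> ('a, 'b) c0) filter" where
  "uniformity_c0 = (INF e\<in>{0<..}. principal {(x, y). dist x y < e})"

definition open_c0 :: "('a, 'b) c0 set \<Rightarrow> bool" where
  "open_c0 S \<longleftrightarrow> (\<forall>x\<in>S. \<forall>\<^sub>F (x', y) in uniformity. x' = x \<longrightarrow> y \<in> S)"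

instance
proof
  show "dist x y = norm (x - y)" for x y :: "('a, 'b) c0" by transfer (rule dist_norm)
  show "norm x = 0 \<longleftrightarrow> x = 0" for x :: "('a, 'b) c0" by transfer simp
  show "norm (x + y) \<le> norm x + norm y" for x y :: "('a, 'b) c0"
    by transfer (rule norm_triangle_ineq)
  show "norm (a *\<^sub>R x) = \<bar>a\<bar> * norm x" for a and x :: "('a, 'b) c0" by transfer simp
qed (simp_all add: sgn_c0_def uniformity_c0_def open_c0_def)

end

lemma apply_c0_simps [simp]:
  "apply_c0 0 x = 0"
  "apply_c0 (f + g) x = apply_c0 f x + apply_c0 g x"
  "apply_c0 (- f) x = - apply_c0 f x"
  "apply_c0 (f - g) x = apply_c0 f x - apply_c0 g x"
  "apply_c0 (r *\<^sub>R f) x = r *\<^sub>R apply_c0 f x"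
  by (simp_all add: apply_c0_def zero_c0.rep_eq plus_c0.rep_eq uminus_c0.rep_eq minus_c0.rep_eq
      scaleR_c0.rep_eq)

instance c0 :: (topological_space, banach) banach
proof
  fix f :: "nat \<Rightarrow> ('a, 'b) c0"
  assume f: "Cauchy f"
  define F where "F n = apply_bcontfun (bcontfun_of_c0 (f n))" for n
  have van: "vanishes_at_infinity (F n)" for n
    using bcontfun_of_c0[of "f n"] unfolding F_def by simp
  have close: "dist (F m x) (F n x) \<le> dist (f m) (f n)" for m n x
    unfolding F_def dist_c0.rep_eq by (rule dist_bounded)
  have "\<exists>N. \<forall>m n x. N \<le> m \<and> N \<le> n \<and> True \<longrightarrow> dist (F m x) (F n x) < e" if "e > 0" for e
    using f that unfolding Cauchy_def by (meson close le_less_trans)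
  then obtain g where g: "uniform_limit UNIV F g sequentially"
    using uniformly_convergent_eq_cauchy[of "\<lambda>_. True" F]
    unfolding uniform_limit_sequentially_iff by auto
  obtain l where l: "g = apply_bcontfun l" "(\<lambda>n. bcontfun_of_c0 (f n)) \<longlonglongrightarrow> l"
    using uniform_limit_bcontfunE[of "\<lambda>n. bcontfun_of_c0 (f n)" g sequentially] g
    unfolding F_def by auto
  have "vanishes_at_infinity l"
    unfolding vanishes_at_infinity_def
  proof (intro allI impI)
    fix e :: real
    assume "e > 0"
    then have "e / 2 > 0" by simp
    then obtain n where n: "\<And>x. dist (F n x) (l x) < e / 2"
      using g unfolding l(1) uniform_limit_sequentially_iff by blast
    obtain K where K: "compact K" "\<And>x. x \<notin> K \<Longrightarrow> norm (F n x) < e / 2"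
      using van[of n] \<open>e / 2 > 0\<close> unfolding vanishes_at_infinity_def by blast
    have "norm (l x) < e" if "x \<notin> K" for x
      using K(2)[OF that] n[of x] norm_triangle_ineq2[of "l x" "F n x"]
      by (simp add: dist_norm norm_minus_commute)
    then show "\<exists>K. compact K \<and> (\<forall>x. x \<notin> K \<longrightarrow> norm (l x) < e)"
      using K(1) by blast
  qed
  then have "bcontfun_of_c0 (Abs_c0 l) = l"
    by (simp add: Abs_c0_inverse)
  then have "f \<longlonglongrightarrow> Abs_c0 l"
    using l(2) by (simp add: tendsto_iff dist_c0.rep_eq)
  then show "convergent f" by (rule convergentI)
qed

lemma bcontfun_compose_bounded_linear:
  assumes "bounded_linear h" "f \<in> bcontfun"
  shows "(\<lambda>x. h (f x)) \<in> bcontfun"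
  using assms bounded_linear_image[of "range f" h]
  by (auto simp: bcontfun_def image_image intro: bounded_linear.continuous_on)

context includes bcontfun.lifting
begin

lift_definition bcontfun_scale ::
  "'k::real_normed_field \<Rightarrow> ('a::topological_space \<Rightarrow>\<^sub>C 'k) \<Rightarrow> ('a \<Rightarrow>\<^sub>C 'k)"
  is "\<lambda>c f x. c * f x"
  by (rule bcontfun_compose_bounded_linear[OF bounded_linear_mult_right])

lift_definition bcontfun_Re :: "('a::topological_space \<Rightarrow>\<^sub>C complex) \<Rightarrow> ('a \<Rightarrow>\<^sub>C real)"
  is "\<lambda>f x. Re (f x)"
  by (rule bcontfun_compose_bounded_linear[OF bounded_linear_Re])

lift_definition bcontfun_Im :: "('a::topological_space \<Rightarrow>\<^sub>C complex) \<Rightarrow> ('a \<Rightarrow>\<^sub>C real)"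
  is "\<lambda>f x. Im (f x)"
  by (rule bcontfun_compose_bounded_linear[OF bounded_linear_Im])

end

lift_definition scale_c0 ::
  "'k::real_normed_field \<Rightarrow> ('a::topological_space, 'k) c0 \<Rightarrow> ('a, 'k) c0" (infixr \<open>*\<^sub>k\<close> 75)
  is bcontfun_scale
  subgoal for c f
    by (erule vanishes_at_infinity_dominated[where c = "norm c"])
      (simp add: bcontfun_scale.rep_eq norm_mult)
  done

lift_definition Re_c0 :: "('a::topological_space, complex) c0 \<Rightarrow> ('a, real) c0" is bcontfun_Re
  by (erule vanishes_at_infinity_dominated[where c = 1])
    (simp add: bcontfun_Re.rep_eq abs_Re_le_cmod)

lift_definition Im_c0 :: "('a::topological_space, complex) c0 \<Rightarrow> ('a, real) c0" is bcontfun_Im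
  by (erule vanishes_at_infinity_dominated[where c = 1])
    (simp add: bcontfun_Im.rep_eq abs_Im_le_cmod)

lemma apply_c0_scale_Re_Im [simp]:
  "apply_c0 (c *\<^sub>k f) x = c * apply_c0 f x"
  "apply_c0 (Re_c0 h) x = Re (apply_c0 h x)"
  "apply_c0 (Im_c0 h) x = Im (apply_c0 h x)"
  by (simp_all add: apply_c0_def scale_c0.rep_eq Re_c0.rep_eq Im_c0.rep_eq
      bcontfun_scale.rep_eq bcontfun_Re.rep_eq bcontfun_Im.rep_eq)

lemma vector_space_scale_c0:
  "vector_space (scale_c0 :: 'k::real_normed_field \<Rightarrow> ('a::topological_space, 'k) c0 \<Rightarrow> _)"
  by unfold_locales (auto intro!: c0_eqI simp: algebra_simps)

lemma norm_c0_eq_SUP: "norm f = (SUP x. norm (apply_c0 f x))"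
  unfolding norm_c0.rep_eq norm_bcontfun_def dist_bcontfun.rep_eq apply_c0_def by simp

section \<open>Operators and semigroups\<close>

definition bounded_operator ::
  "(('a::topological_space, 'k::real_normed_field) c0 \<Rightarrow> ('a, 'k) c0) \<Rightarrow> bool" where
  "bounded_operator S \<longleftrightarrow> Vector_Spaces.linear (*\<^sub>k) (*\<^sub>k) S \<and> bounded_linear S"

text \<open>The values of a semigroup at negative times are irrelevant junk.\<close>

definition C0_semigroup ::
  "(real \<Rightarrow> ('a::topological_space, 'k::real_normed_field) c0 \<Rightarrow> ('a, 'k) c0) \<Rightarrow> bool" where
  "C0_semigroup T \<longleftrightarrow>
     (\<forall>t\<ge>0. bounded_operator (T t)) \<and>
     T 0 = id \<and>
     (\<forall>s\<ge>0. \<forall>t\<ge>0. T (s + t) = T s \<circ> T t) \<and>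
     (\<forall>f. ((\<lambda>t. T t f) \<longlongrightarrow> f) (at_right 0))"

text \<open>Unbounded operators are represented by their graphs.\<close>

definition generator :: "(real \<Rightarrow> 'e::real_normed_vector \<Rightarrow> 'e) \<Rightarrow> ('e \<times> 'e) set" where
  "generator T = {(f, g). ((\<lambda>t. (T t f - f) /\<^sub>R t) \<longlongrightarrow> g) (at_right 0)}"

text \<open>The operator \<open>R\<close> below is the bounded two-sided inverse of
  \<open>\<mu> - A : dom A \<rightarrow> E\<close>.\<close>

definition resolvent_set ::
  "(('a::topological_space, complex) c0 \<times> ('a, complex) c0) set \<Rightarrow> complex set" where
  "resolvent_set A = {\<mu>. \<exists>R. bounded_operator R \<and>
     (\<forall>g. (R g, \<mu> *\<^sub>k R g - g) \<in> A) \<and>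
     (\<forall>(f, h)\<in>A. R (\<mu> *\<^sub>k f - h) = f)}"

definition spectrum ::
  "(('a::topological_space, complex) c0 \<times> ('a, complex) c0) set \<Rightarrow> complex set" where
  "spectrum A = - resolvent_set A"

text \<open>The canonical extension \<open>A (u + \<i> v) = A u + \<i> A v\<close> of an operator on the
  real space to the complex space; the spectrum of a real operator is by convention that of its
  complexification.\<close>

definition complexification ::
  "(('a::topological_space, real) c0 \<times> ('a, real) c0) set \<Rightarrow>
     (('a, complex) c0 \<times> ('a, complex) c0) set" where
  "complexification A = {(f, g). (Re_c0 f, Re_c0 g) \<in> A \<and> (Im_c0 f, Im_c0 g) \<in> A}"

section \<open>Order-theoretic properties\<close>

definition real_c0 :: "('a::topological_space, 'k::real_normed_field) c0 \<Rightarrow> bool" where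
  "real_c0 f \<longleftrightarrow> (\<forall>x. apply_c0 f x \<in> \<real>)"

definition nonneg_c0 :: "('a::topological_space, 'k::real_normed_field) c0 \<Rightarrow> bool" where
  "nonneg_c0 f \<longleftrightarrow> (\<forall>x. apply_c0 f x \<in> \<real>\<^sub>\<ge>\<^sub>0)"

definition real_semigroup ::
  "(real \<Rightarrow> ('a::topological_space, 'k::real_normed_field) c0 \<Rightarrow> ('a, 'k) c0) \<Rightarrow> bool" where
  "real_semigroup T \<longleftrightarrow> (\<forall>t\<ge>0. \<forall>f. real_c0 f \<longrightarrow> real_c0 (T t f))"

definition individually_eventually_positive ::
  "(real \<Rightarrow> ('a::topological_space, 'k::real_normed_field) c0 \<Rightarrow> ('a, 'k) c0) \<Rightarrow> bool" where
  "individually_eventually_positive T \<longleftrightarrow>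
     (\<forall>f. nonneg_c0 f \<longrightarrow> (\<exists>t0\<ge>0. \<forall>t\<ge>t0. nonneg_c0 (T t f)))"

text \<open>Lattice ideals: vector subspaces \<open>I\<close> such that \<open>|f| \<le> |g|\<close> and
  \<open>g \<in> I\<close> imply \<open>f \<in> I\<close>.\<close>

definition lattice_ideal :: "('a::topological_space, 'k::real_normed_field) c0 set \<Rightarrow> bool" where
  "lattice_ideal I \<longleftrightarrow> module.subspace (*\<^sub>k) I \<and>
     (\<forall>g\<in>I. \<forall>f. (\<forall>x. norm (apply_c0 f x) \<le> norm (apply_c0 g x)) \<longrightarrow> f \<in> I)"

definition uniformly_eventually_invariant ::
  "(real \<Rightarrow> ('a::topological_space, 'k::real_normed_field) c0 \<Rightarrow> ('a, 'k) c0) \<Rightarrow>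
     ('a, 'k) c0 set \<Rightarrow> bool" where
  "uniformly_eventually_invariant T I \<longleftrightarrow> (\<exists>t0\<ge>0. \<forall>t\<ge>t0. T t ` I \<subseteq> I)"

definition persistently_irreducible ::
  "(real \<Rightarrow> ('a::topological_space, 'k::real_normed_field) c0 \<Rightarrow> ('a, 'k) c0) \<Rightarrow> bool" where
  "persistently_irreducible T \<longleftrightarrow>
     (\<forall>I. closed I \<and> lattice_ideal I \<and> uniformly_eventually_invariant T I \<longrightarrow>
       I = {0} \<or> I = UNIV)"

end

theory Submission
  imports Defs "HOL-Complex_Analysis.Complex_Analysis"
begin

text \<open>Suppose that the spectrum is empty, and let \<open>R = R(l, A)\<close> with \<open>l\<close> above
  the growth bound. If the orbit of \<open>v\<close> stays positive, then \<open>exp (- l t) T(t) R v\<close> decreases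
  to \<open>0\<close>, so the orbit of \<open>u = R v\<close> is positive and \<open>T(t) u \<le> exp (l t) u\<close>.
  By Baire's theorem on the order interval \<open>[- u, u]\<close>, the domination \<open>|T(t) g| \<le> K T(t) u\<close>,
  which for each single \<open>g\<close> holds eventually, holds from a common time on. The closed ideal
  generated by \<open>u\<close> is therefore uniformly eventually invariant, and \<open>u\<close> is strictly positive.
  Take \<open>f \<ge> 0\<close> nonzero with compact support and \<open>v = T(t0) f\<close> with \<open>t0\<close> large; then
  \<open>f \<le> C u\<close>, and applying \<open>R^k T(s)\<close> with \<open>s\<close> large yields
  \<open>R^(k+1) w \<ge> c R^k w\<close> for \<open>w = T(s) f\<close>. So \<open>R^k w \<ge> c^k w\<close>,
  whereas \<open>z \<mapsto> (R(l - z, A) w)(x)\<close> would be an entire function with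
  Taylor coefficients \<open>(R^(k+1) w)(x)\<close>.\<close>

text \<open>Baire is needed relative to a closed set \<open>S\<close>, because the order interval to
  which it is applied below may have empty interior in the whole space. The case
  \<open>S = UNIV\<close> gives the uniform bound near time \<open>0\<close>.\<close>

lemma Baire_closed_cover:
  fixes S :: "'a::complete_space set" and V :: "nat \<Rightarrow> 'a set"
  assumes "closed S" "S \<noteq> {}" "\<And>n. closed (V n)" "S \<subseteq> (\<Union>n. V n)"
  shows "\<exists>n. \<exists>x\<in>S. \<exists>e>0. \<forall>y\<in>S. dist y x < e \<longrightarrow> y \<in> V n"
proof -
  have cm: "completely_metrizable_space (top_of_set S)"
    using completely_metrizable_space_closedin[OF completely_metrizable_space_euclidean, of S] assms(1)
    by simp
  have "\<exists>n. (top_of_set S) interior_of (S \<inter> V n) \<noteq> {}"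
  proof (rule ccontr)
    assume "\<not> ?thesis"
    then have e: "\<And>n. (top_of_set S) interior_of (S \<inter> V n) = {}" by auto
    have "(top_of_set S) interior_of (\<Union>(range (\<lambda>n. S \<inter> V n))) = {}"
      by (rule Baire_category_alt) (use cm e assms(3) in \<open>auto intro!: closedin_closed_Int\<close>)
    moreover have "\<Union>(range (\<lambda>n. S \<inter> V n)) = S" using assms(4) by auto
    ultimately show False using assms(2)
      using interior_of_topspace[of "top_of_set S"] by simp
  qed
  then obtain n x where x: "x \<in> (top_of_set S) interior_of (S \<inter> V n)" by auto
  then obtain U where U: "openin (top_of_set S) U" "x \<in> U" "U \<subseteq> S \<inter> V n"
    by (auto simp: interior_of_def)
  then obtain e where "e > 0" "ball x e \<inter> S \<subseteq> U" by (auto simp: openin_contains_ball)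
  with U show ?thesis
    by (intro exI[of _ n] bexI[of _ x] exI[of _ e]) (auto simp: subset_eq dist_commute[of _ x])
qed

section \<open>Strongly continuous semigroups\<close>

locale sc_semigroup =
  fixes T :: "real \<Rightarrow> 'e::banach \<Rightarrow> 'e"
  assumes bounded_linear_T: "0 \<le> t \<Longrightarrow> bounded_linear (T t)"
    and T_0: "T 0 f = f"
    and T_add: "0 \<le> s \<Longrightarrow> 0 \<le> t \<Longrightarrow> T (s + t) f = T s (T t f)"
    and tendsto_0: "((\<lambda>t. T t f) \<longlongrightarrow> f) (at_right 0)"
begin

lemmas T_lin [simp] =
  bounded_linear_T[THEN bounded_linear.linear, THEN linear_add]
  bounded_linear_T[THEN bounded_linear.linear, THEN linear_diff]
  bounded_linear_T[THEN bounded_linear.linear, THEN linear_neg]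
  bounded_linear_T[THEN bounded_linear.linear, THEN linear_cmul]
  bounded_linear_T[THEN bounded_linear.linear, THEN linear_0]

lemma tendsto_T:
  assumes "0 \<le> t" "(f \<longlongrightarrow> l) F" shows "((\<lambda>x. T t (f x)) \<longlongrightarrow> T t l) F"
  by (rule bounded_linear.tendsto[OF bounded_linear_T[OF assms(1)] assms(2)])

lemma continuous_on_T: "0 \<le> t \<Longrightarrow> continuous_on A (T t)"
  by (simp add: bounded_linear_T linear_continuous_on)

lemma near_0:
  assumes "e > 0" obtains d where "d > 0" "\<And>h. 0 \<le> h \<Longrightarrow> h < d \<Longrightarrow> norm (T h f - f) < e"
proof -
  have "\<forall>\<^sub>F t in at_right 0. dist (T t f) f < e"
    using tendsto_0 assms by (rule tendstoD)
  then obtain d where "d > 0" "\<And>h. 0 < h \<Longrightarrow> h < d \<Longrightarrow> norm (T h f - f) < e"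
    unfolding eventually_at_right_field by (auto simp: dist_norm)
  with that[of d] assms T_0 show ?thesis by (metis diff_self less_eq_real_def norm_zero)
qed

text \<open>Strong continuity bounds each single orbit near \<open>0\<close>. In \<open>V n\<close>
  the index controls both the bound and the length of the time interval, so that countably many
  closed sets cover the space; a ball inside one of them gives the operator bound by
  linearity.\<close>

lemma bounded_near_0:
  obtains d M where "d > 0" "M \<ge> 1" "\<And>t f. 0 \<le> t \<Longrightarrow> t \<le> d \<Longrightarrow> norm (T t f) \<le> M * norm f"
proof -
  define V where "V n = (\<Inter>t\<in>{0..1 / real (Suc n)}. {f. norm (T t f) \<le> real n})" for n
  have cl: "closed (V n)" for n
    unfolding V_def by (intro closed_INT ballI closed_Collect_le continuous_intros continuous_on_T) auto
  have cov: "UNIV \<subseteq> (\<Union>n. V n)"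
  proof
    fix f
    obtain d where d: "d > 0" "\<And>h. 0 \<le> h \<Longrightarrow> h < d \<Longrightarrow> norm (T h f - f) < 1"
      using near_0[of 1 f] by auto
    obtain n where n: "max (1 / d) (norm f + 1) < real n" using reals_Archimedean2 by blast
    have "norm (T t f) \<le> real n" if t: "0 \<le> t" "t \<le> 1 / real (Suc n)" for t
    proof -
      have "1 / real (Suc n) < d" using n d(1)
        by (auto simp: field_simps)
      then have "norm (T t f - f) < 1" using d t by auto
      then show ?thesis using n norm_triangle_sub[of "T t f" f] by auto
    qed
    then have "f \<in> V n" by (auto simp: V_def)
    then show "f \<in> (\<Union>n. V n)" by blast
  qed
  obtain n g e where *: "e > 0" "\<And>y. dist y g < e \<Longrightarrow> y \<in> V n"
    using Baire_closed_cover[OF closed_UNIV UNIV_not_empty cl cov] by (metis UNIV_I)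
  define M where "M = 4 * real n / e + 1"
  have "norm (T t f) \<le> M * norm f" if t: "0 \<le> t" "t \<le> 1 / real (Suc n)" for t f
  proof (cases "f = 0")
    case True then show ?thesis using t by simp
  next
    case False
    define h where "h = (e / (2 * norm f)) *\<^sub>R f"
    have h: "norm h = e / 2" using False * by (simp add: h_def)
    have "g + h \<in> V n" "g \<in> V n" using *(1) h by (auto intro!: *(2) simp: dist_norm)
    then have "norm (T t (g + h)) \<le> n" "norm (T t g) \<le> n" using t by (auto simp: V_def)
    then have "norm (T t h) \<le> 2 * n"
      using norm_triangle_ineq4[of "T t (g + h)" "T t g"] t by simp
    moreover have "T t h = (e / (2 * norm f)) *\<^sub>R T t f" using t by (simp add: h_def)
    ultimately have "e / (2 * norm f) * norm (T t f) \<le> 2 * n" using * by simp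
    then have "norm (T t f) \<le> 4 * n / e * norm f" using False *(1) by (simp add: field_simps)
    also have "\<dots> \<le> M * norm f" by (intro mult_right_mono) (auto simp: M_def)
    finally show ?thesis .
  qed
  then show ?thesis using *(1) by (intro that[of "1 / real (Suc n)" M]) (auto simp: M_def)
qed

text \<open>Cut \<open>[0, t]\<close> into \<open>n = \<lceil>t / d\<rceil>\<close> pieces of length
  at most \<open>d\<close>. Since \<open>n \<le> t / d + 1\<close>, the factor \<open>M ^ n\<close>
  is at most \<open>M * exp (w * t)\<close> with \<open>w = ln M / d\<close>.\<close>

lemma growth_bound:
  obtains M w where "M \<ge> 1" "w \<ge> 0" "\<And>t f. 0 \<le> t \<Longrightarrow> norm (T t f) \<le> M * exp (w * t) * norm f"
proof -
  obtain d M where d: "d > 0" "M \<ge> 1" and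
    M: "\<And>t f. 0 \<le> t \<Longrightarrow> t \<le> d \<Longrightarrow> norm (T t f) \<le> M * norm f"
    using bounded_near_0 by blast
  have step: "norm (T t f) \<le> M ^ n * norm f" if "0 \<le> t" "t \<le> real n * d" for n t f
    using that
  proof (induction n arbitrary: t f)
    case 0 then show ?case by (simp add: T_0)
  next
    case (Suc n)
    show ?case
    proof (cases "t \<le> d")
      case True
      have "M * norm f \<le> M ^ Suc n * norm f"
        using d power_increasing[of 1 "Suc n" M] by (intro mult_right_mono) auto
      then show ?thesis using M[of t f] True Suc.prems by linarith
    next
      case False
      have "norm (T (d + (t - d)) f) = norm (T d (T (t - d) f))"
        using False d by (subst T_add) auto
      also have "\<dots> \<le> M * norm (T (t - d) f)" using M d by auto
      also have "\<dots> \<le> M * (M ^ n * norm f)"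
        using Suc.IH[of "t - d" f] Suc.prems False d
        by (intro mult_left_mono) (auto simp: algebra_simps)
      finally show ?thesis by (simp add: mult.assoc)
    qed
  qed
  have "norm (T t f) \<le> M * exp (ln M / d * t) * norm f" if t: "0 \<le> t" for t f
  proof -
    define n where "n = nat \<lceil>t / d\<rceil>"
    have n: "t / d \<le> n" "n \<le> t / d + 1" using t d by (auto simp: n_def)
    then have "norm (T t f) \<le> M ^ n * norm f" using t d by (intro step) (auto simp: field_simps)
    also have "M ^ n = exp (n * ln M)" using d by (simp add: exp_of_nat_mult)
    also have "\<dots> \<le> exp ((t / d + 1) * ln M)"
      using n d by (intro exp_mono mult_right_mono) auto
    also have "\<dots> = M * exp (ln M / d * t)" using d by (simp add: algebra_simps exp_add)
    finally show ?thesis by (simp add: mult_right_mono)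
  qed
  then show ?thesis using d by (intro that[of M "ln M / d"]) auto
qed

lemma locally_bounded:
  fixes b :: real
  obtains C where "C > 0" "\<And>t f. 0 \<le> t \<Longrightarrow> t \<le> b \<Longrightarrow> norm (T t f) \<le> C * norm f"
proof -
  obtain M w where M: "M \<ge> 1" "w \<ge> 0" "\<And>t f. 0 \<le> t \<Longrightarrow> norm (T t f) \<le> M * exp (w * t) * norm f"
    using growth_bound by blast
  show ?thesis
  proof (rule that[of "M * exp (w * b)"])
    show "M * exp (w * b) > 0" using M by auto
    fix t :: real and f :: 'e assume t: "0 \<le> t" "t \<le> b"
    have "M * exp (w * t) * norm f \<le> M * exp (w * b) * norm f"
      using M t by (intro mult_right_mono mult_left_mono) (auto intro!: mult_left_mono)
    then show "norm (T t f) \<le> M * exp (w * b) * norm f" using M(3)[OF t(1), of f] by linarith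
  qed
qed

text \<open>Continuity from the right at \<open>0\<close> suffices on both sides of
  \<open>s\<close>: the operator at the smaller of the two times is factored out, and it is bounded
  uniformly near \<open>s\<close>.\<close>

lemma orbit_continuous: "continuous_on {0..} (\<lambda>t. T t f)"
  unfolding continuous_on_iff
proof (intro ballI allI impI)
  fix s e :: real assume s: "s \<in> {0..}" and e: "e > 0"
  obtain C where C: "C > 0" "\<And>t f. 0 \<le> t \<Longrightarrow> t \<le> s + 1 \<Longrightarrow> norm (T t f) \<le> C * norm f"
    using locally_bounded[of "s + 1"] by blast
  obtain d where d: "d > 0" "\<And>h. 0 \<le> h \<Longrightarrow> h < d \<Longrightarrow> norm (T h f - f) < e / C"
    using near_0[of "e / C" f] e C by auto
  have *: "dist (T b f) (T a f) < e" if "0 \<le> a" "a \<le> b" "a \<le> s + 1" "b - a < d" for a b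
  proof -
    have "T b f - T a f = T a (T (b - a) f - f)"
      using that T_add[of a "b - a" f] by simp
    also have "norm \<dots> \<le> C * norm (T (b - a) f - f)" by (rule C(2)) (use that in auto)
    also have "\<dots> < C * (e / C)" using C d that by (intro mult_strict_left_mono) auto
    finally show ?thesis using C by (simp add: dist_norm)
  qed
  show "\<exists>d>0. \<forall>t\<in>{0..}. dist t s < d \<longrightarrow> dist (T t f) (T s f) < e"
  proof (intro exI[of _ "min d 1"] conjI ballI impI)
    fix t assume "t \<in> {0..}" "dist t s < min d 1"
    then show "dist (T t f) (T s f) < e"
      using *[of s t] *[of t s] s by (cases "t \<le> s") (auto simp: dist_real_def dist_commute)
  qed (use d in auto)
qed

lemma generator_shift: "(g, h) \<in> generator T \<Longrightarrow> 0 \<le> t \<Longrightarrow> (T t g, T t h) \<in> generator T"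
proof -
  assume g: "(g, h) \<in> generator T" and t: "0 \<le> t"
  have "((\<lambda>s. T t ((T s g - g) /\<^sub>R s)) \<longlongrightarrow> T t h) (at_right 0)"
    by (rule tendsto_T[OF t]) (use g in \<open>simp add: generator_def\<close>)
  moreover have "\<forall>\<^sub>F s in at_right 0. T t ((T s g - g) /\<^sub>R s) = (T s (T t g) - T t g) /\<^sub>R s"
    using eventually_at_right_less[of 0]
    by eventually_elim (use t in \<open>simp flip: T_add add: add.commute\<close>)
  ultimately show ?thesis by (simp add: generator_def tendsto_cong)
qed

text \<open>The generator is a one-sided derivative at \<open>0\<close>. For \<open>a < b\<close>
  the difference quotient is \<open>T a\<close> applied to a quotient at \<open>0\<close> of step
  \<open>b - a\<close>; taking \<open>s\<close> as either endpoint gives both one-sided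
  derivatives.\<close>

lemma orbit_derivative:
  assumes g: "(g, h) \<in> generator T" and s: "s > 0"
  shows "((\<lambda>t. T t g) has_vector_derivative T s h) (at s)"
  unfolding has_vector_derivative_def has_derivative_at_within
proof (intro conjI bounded_linear_scaleR_left)
  have "((\<lambda>t. (T t g - T s g) /\<^sub>R (t - s) - T s h) \<longlongrightarrow> 0) (at s)"
  proof (rule tendstoI)
    fix e :: real assume e: "e > 0"
    obtain C where C: "C > 0" "\<And>t f. 0 \<le> t \<Longrightarrow> t \<le> s + 1 \<Longrightarrow> norm (T t f) \<le> C * norm f"
      using locally_bounded[of "s + 1"] by blast
    have "\<forall>\<^sub>F t in at_right 0. dist ((T t g - g) /\<^sub>R t) h < e / (2 * C)"
      by (rule tendstoD) (use g e C in \<open>auto simp: generator_def\<close>)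
    then obtain d where d: "d > 0" "\<And>t. 0 < t \<Longrightarrow> t < d \<Longrightarrow> norm ((T t g - g) /\<^sub>R t - h) < e / (2 * C)"
      unfolding eventually_at_right_field by (auto simp: dist_norm)
    obtain d' where d': "d' > 0" "\<And>t. t \<ge> 0 \<Longrightarrow> dist t s < d' \<Longrightarrow> dist (T t h) (T s h) < e / 2"
      using orbit_continuous[of h] s e unfolding continuous_on_iff
      by (metis atLeast_iff half_gt_zero less_eq_real_def)
    have *: "norm ((T b g - T a g) /\<^sub>R (b - a) - T s h) < e"
      if "0 \<le> a" "a < b" "a \<le> s + 1" "b - a < d" "dist a s < d'" for a b
    proof -
      have "(T b g - T a g) /\<^sub>R (b - a) - T s h =
        T a ((T (b - a) g - g) /\<^sub>R (b - a) - h) + (T a h - T s h)"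
        using that T_add[of a "b - a" g] by simp
      also have "norm \<dots> \<le> C * norm ((T (b - a) g - g) /\<^sub>R (b - a) - h) + norm (T a h - T s h)"
        by (intro norm_triangle_mono C(2) order_refl) (use that in auto)
      also have "\<dots> < C * (e / (2 * C)) + e / 2"
        using C d(2)[of "b - a"] d'(2)[of a] that
        by (intro add_strict_mono mult_strict_left_mono) (auto simp: dist_norm)
      finally show ?thesis using C by simp
    qed
    have "dist ((T t g - T s g) /\<^sub>R (t - s) - T s h) 0 < e"
      if "dist t s < min (min d d') (min 1 s)" "t \<noteq> s" for t
    proof (cases "t < s")
      case True
      have "(T t g - T s g) /\<^sub>R (t - s) = (T s g - T t g) /\<^sub>R (s - t)"
        by (metis minus_diff_eq scaleR_minus_left scaleR_minus_right inverse_minus_eq minus_minus)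
      then show ?thesis using *[of t s] True that by (auto simp: dist_real_def)
    next
      case False
      then show ?thesis using *[of s t] that s by (auto simp: dist_real_def)
    qed
    moreover have "min (min d d') (min 1 s) > 0" using d d' s by auto
    ultimately show "\<forall>\<^sub>F t in at s. dist ((T t g - T s g) /\<^sub>R (t - s) - T s h) 0 < e"
      unfolding eventually_at by blast
  qed
  then have "((\<lambda>t. norm ((T t g - T s g) /\<^sub>R (t - s) - T s h)) \<longlongrightarrow> 0) (at s)"
    by (rule tendsto_norm_zero)
  moreover have "norm ((T t g - T s g) /\<^sub>R (t - s) - T s h) =
      norm ((T t g - T s g - (t - s) *\<^sub>R T s h) /\<^sub>R norm (t - s))" if "t \<noteq> s" for t
  proof -
    have "(T t g - T s g) /\<^sub>R (t - s) - T s h = (T t g - T s g - (t - s) *\<^sub>R T s h) /\<^sub>R (t - s)"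
      using that by (simp add: scaleR_diff_right[of "inverse (t - s)"])
    then show ?thesis by simp
  qed
  ultimately have "((\<lambda>t. norm ((T t g - T s g - (t - s) *\<^sub>R T s h) /\<^sub>R norm (t - s))) \<longlongrightarrow> 0) (at s)"
    by (subst (asm) tendsto_cong) (auto simp: eventually_at_filter)
  then show "((\<lambda>t. (T t g - T s g - (t - s) *\<^sub>R T s h) /\<^sub>R norm (t - s)) \<longlongrightarrow> 0) (at s)"
    by (rule tendsto_norm_zero_cancel)
qed

text \<open>The assumption on \<open>g\<close> says \<open>A g = l g - v\<close>, that is,
  \<open>g = R(l, A) v\<close>. Hence the derivative of \<open>exp (- l r) \<psi> (T r g)\<close> is
  \<open>- exp (- l r) \<psi> (T r v)\<close>, which is nonpositive. Later \<open>\<psi>\<close> is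
  a point evaluation.\<close>

lemma rescaled_orbit_antimono:
  fixes \<psi> :: "'e \<Rightarrow> real"
  assumes g: "(g, l *\<^sub>R g - v) \<in> generator T" and psi: "bounded_linear \<psi>"
    and v: "\<And>s. 0 \<le> s \<Longrightarrow> 0 \<le> \<psi> (T s v)" and st: "0 \<le> s" "s \<le> t"
  shows "exp (- (l * t)) * \<psi> (T t g) \<le> exp (- (l * s)) * \<psi> (T s g)"
proof -
  have "\<exists>y. ((\<lambda>r. exp (- (l * r)) * \<psi> (T r g)) has_real_derivative y) (at r) \<and> y \<le> 0" if r: "s < r" for r
  proof -
    have "((\<lambda>r. \<psi> (T r g)) has_real_derivative \<psi> (T r (l *\<^sub>R g - v))) (at r)"
      unfolding has_real_derivative_iff_has_vector_derivative
      by (rule bounded_linear.has_vector_derivative[OF psi orbit_derivative[OF g]]) (use r st in auto)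
    then have "((\<lambda>r. exp (- (l * r)) * \<psi> (T r g)) has_real_derivative
        exp (- (l * r)) * (- l) * \<psi> (T r g) + \<psi> (T r (l *\<^sub>R g - v)) * exp (- (l * r))) (at r)"
      by (auto intro!: derivative_eq_intros)
    moreover have "\<psi> (T r (l *\<^sub>R g - v)) = l * \<psi> (T r g) - \<psi> (T r v)"
      using r st psi by (simp add: bounded_linear.linear linear_diff linear_cmul)
    moreover have "exp (- (l * r)) * (- l) * \<psi> (T r g) + (l * \<psi> (T r g) - \<psi> (T r v)) * exp (- (l * r))
        = - (exp (- (l * r)) * \<psi> (T r v))"
      by (simp add: algebra_simps)
    ultimately show ?thesis using v[of r] r st by (intro exI[of _ "- (exp (- (l * r)) * \<psi> (T r v))"]) auto
  qed
  \<comment> \<open>The derivative is available only at positive times, so the endpoint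
    \<open>s = 0\<close> is reached by continuity.\<close>
  moreover have "continuous_on {s..t} (\<lambda>r. exp (- (l * r)) * \<psi> (T r g))"
    by (intro continuous_intros bounded_linear.continuous_on[OF psi]
        continuous_on_subset[OF orbit_continuous]) (use st in auto)
  ultimately show ?thesis using DERIV_nonpos_imp_decreasing_open[OF st(2)] by blast
qed

text \<open>The rescaled orbit is decreasing, and as \<open>l\<close> exceeds the growth exponent
  \<open>w\<close> it tends to \<open>0\<close>; so it is never negative. This takes the place of
  the Laplace transform formula for the resolvent.\<close>

lemma resolvent_orbit_nonneg:
  fixes \<psi> :: "'e \<Rightarrow> real"
  assumes growth: "\<And>t f. 0 \<le> t \<Longrightarrow> norm (T t f) \<le> M * exp (w * t) * norm f" and l: "w < l"
    and g: "(g, l *\<^sub>R g - v) \<in> generator T" and psi: "bounded_linear \<psi>"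
    and v: "\<And>s. 0 \<le> s \<Longrightarrow> 0 \<le> \<psi> (T s v)" and s: "0 \<le> s"
  shows "0 \<le> \<psi> (T s g)"
proof -
  obtain K where K: "\<And>f. norm (\<psi> f) \<le> norm f * K" "K > 0"
    using bounded_linear.pos_bounded[OF psi] by blast
  have lim: "((\<lambda>t. exp (- (l * t)) * \<psi> (T t g)) \<longlongrightarrow> 0) at_top"
  proof (rule tendsto_0_le[where K = 1])
    have "filterlim (\<lambda>t. (l - w) * t) at_top at_top"
      using l by (intro filterlim_tendsto_pos_mult_at_top[OF tendsto_const _ filterlim_ident]) auto
    then have "((\<lambda>t. exp (- ((l - w) * t))) \<longlongrightarrow> 0) at_top"
      by (intro filterlim_compose[OF exp_at_bot] filterlim_uminus_at_bot_at_top[THEN filterlim_compose])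
    then show "((\<lambda>t. exp (- ((l - w) * t)) * (M * norm g * K)) \<longlongrightarrow> 0) at_top"
      by (rule tendsto_mult_left_zero)
    show "\<forall>\<^sub>F t in at_top. norm (exp (- (l * t)) * \<psi> (T t g))
        \<le> norm (exp (- ((l - w) * t)) * (M * norm g * K)) * 1"
      using eventually_ge_at_top[of 0]
    proof eventually_elim
      case (elim t)
      have "norm (exp (- (l * t)) * \<psi> (T t g)) \<le> exp (- (l * t)) * (norm (T t g) * K)"
        using K(1)[of "T t g"] by (simp add: abs_mult)
      also have "\<dots> \<le> exp (- (l * t)) * (M * exp (w * t) * norm g * K)"
        using growth[OF elim, of g] K by simp
      also have "\<dots> = exp (- ((l - w) * t)) * (M * norm g * K)"
        by (simp add: algebra_simps flip: exp_add)
      finally show ?case by simp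
    qed
  qed
  have "0 \<le> exp (- (l * s)) * \<psi> (T s g)"
  proof (rule tendsto_upperbound[OF lim])
    show "\<forall>\<^sub>F t in at_top. exp (- (l * t)) * \<psi> (T t g) \<le> exp (- (l * s)) * \<psi> (T s g)"
      using eventually_ge_at_top[of s]
      by eventually_elim (use rescaled_orbit_antimono[OF g psi v s] in auto)
  qed auto
  then show ?thesis by (simp add: zero_le_mult_iff)
qed

end

section \<open>Functions vanishing at infinity\<close>

lemma continuous_on_apply_c0 [continuous_intros]: "continuous_on A (apply_c0 f)"
  unfolding apply_c0_def by (rule continuous_on_apply_bcontfun)

lemma norm_apply_c0_le: "norm (apply_c0 f x) \<le> norm f"
  unfolding apply_c0_def norm_c0.rep_eq by (rule norm_bounded)

lemma norm_c0_le: "(\<And>x. norm (apply_c0 f x) \<le> b) \<Longrightarrow> norm f \<le> b"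
  unfolding norm_c0_eq_SUP by (rule cSUP_least) auto

lemma bounded_linear_apply_c0: "bounded_linear (\<lambda>f. apply_c0 f x)"
  by (rule bounded_linear_intro[where K = 1]) (simp_all add: norm_apply_c0_le)

lemma tendsto_apply_c0: "(f \<longlongrightarrow> l) F \<Longrightarrow> ((\<lambda>y. apply_c0 (f y) x) \<longlongrightarrow> apply_c0 l x) F"
  by (rule bounded_linear.tendsto[OF bounded_linear_apply_c0])

lemma apply_c0_sum: "apply_c0 (sum f A) x = (\<Sum>a\<in>A. apply_c0 (f a) x)"
  by (induction A rule: infinite_finite_induct) auto

text \<open>Boundedness, which the underlying type demands, comes from compactness on
  \<open>K\<close> and from the bound \<open>1\<close> outside \<open>K\<close>.\<close>

lemma apply_c0_surj:
  fixes f :: "'a::topological_space \<Rightarrow> 'k::real_normed_vector"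
  assumes "continuous_on UNIV f" "vanishes_at_infinity f"
  obtains h where "\<And>x. apply_c0 h x = f x"
proof -
  obtain K where K: "compact K" "\<And>x. x \<notin> K \<Longrightarrow> norm (f x) < 1"
    using assms(2)[unfolded vanishes_at_infinity_def, rule_format, of 1] by auto
  have "bounded (f ` K)"
    by (intro compact_imp_bounded compact_continuous_image K(1) continuous_on_subset[OF assms(1)]) simp
  then obtain B where "\<And>x. x \<in> K \<Longrightarrow> norm (f x) \<le> B" by (auto simp: bounded_iff)
  then have "norm (f x) \<le> max B 1" for x
    using K(2)[of x] by (cases "x \<in> K") (fastforce simp: le_max_iff_disj)+
  then have "bounded (range f)" by (auto simp: bounded_iff)
  then have f: "f \<in> bcontfun" using assms(1) by (simp add: bcontfun_def)
  show ?thesis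
    by (rule that[of "Abs_c0 (Bcontfun f)"])
      (simp add: apply_c0_def Abs_c0_inverse Bcontfun_inverse[OF f] assms(2))
qed

lemma vanishes_at_infinity_apply_c0: "vanishes_at_infinity (apply_c0 f)"
  using bcontfun_of_c0[of f] by (simp add: apply_c0_def)

lemma apply_c0_surj_dominated:
  assumes "continuous_on UNIV f" "\<And>x. norm (f x) \<le> norm (apply_c0 g x)"
  obtains h where "\<And>x. apply_c0 h x = f x"
  using apply_c0_surj[OF assms(1)]
    vanishes_at_infinity_dominated[OF vanishes_at_infinity_apply_c0, of f 1 g] assms(2) by auto

lemma norm_scale_c0: "norm (c *\<^sub>k f) = norm c * norm f"
proof (rule antisym)
  have le: "norm (c *\<^sub>k f) \<le> norm c * norm f" for c and f :: "('a::topological_space, 'b::real_normed_field) c0"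
    by (rule norm_c0_le) (simp add: norm_mult mult_left_mono norm_apply_c0_le)
  then show "norm (c *\<^sub>k f) \<le> norm c * norm f" .
  show "norm c * norm f \<le> norm (c *\<^sub>k f)"
  proof (cases "c = 0")
    case False
    have "f = inverse c *\<^sub>k (c *\<^sub>k f)" using False by (intro c0_eqI) simp
    then have "norm f \<le> norm (inverse c) * norm (c *\<^sub>k f)" using le by metis
    then show ?thesis using False by (simp add: norm_inverse norm_divide field_simps)
  qed simp
qed

text \<open>The embedding of the real space into its complexification. The choice is unique, since
  elements are determined by their values.\<close>

definition complex_c0 :: "('a::topological_space, real) c0 \<Rightarrow> ('a, complex) c0" where
  "complex_c0 f = (SOME h. \<forall>x. apply_c0 h x = complex_of_real (apply_c0 f x))"

lemma apply_complex_c0 [simp]: "apply_c0 (complex_c0 f) x = complex_of_real (apply_c0 f x)"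
proof -
  have "\<exists>h. \<forall>x. apply_c0 h x = complex_of_real (apply_c0 f x)"
    by (rule apply_c0_surj_dominated[of "\<lambda>x. complex_of_real (apply_c0 f x)" f])
      (auto intro!: continuous_intros)
  from someI_ex[OF this] show ?thesis unfolding complex_c0_def by blast
qed

lemma Re_Im_complex_c0 [simp]: "Re_c0 (complex_c0 f) = f" "Im_c0 (complex_c0 f) = 0"
  by (auto intro!: c0_eqI)

lemma complex_c0_simps [simp]: "complex_c0 0 = 0" "complex_c0 (f - g) = complex_c0 f - complex_c0 g"
  "complex_c0 (r *\<^sub>R f) = of_real r *\<^sub>k complex_c0 f"
  by (auto intro!: c0_eqI)

lemma complex_c0_Re: "Im_c0 f = 0 \<Longrightarrow> complex_c0 (Re_c0 f) = f"
proof (rule c0_eqI)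
  fix x assume "Im_c0 f = 0"
  then have "Im (apply_c0 f x) = 0" by (metis apply_c0_scale_Re_Im(3) apply_c0_simps(1))
  then show "apply_c0 (complex_c0 (Re_c0 f)) x = apply_c0 f x" by (simp add: complex_eq_iff)
qed

lemma Re_Im_c0_simps:
  "Re_c0 (f - g) = Re_c0 f - Re_c0 g" "Im_c0 (f - g) = Im_c0 f - Im_c0 g"
  "Re_c0 (of_real r *\<^sub>k f) = r *\<^sub>R Re_c0 f" "Im_c0 (of_real r *\<^sub>k f) = r *\<^sub>R Im_c0 f"
  by (auto intro!: c0_eqI)

lemma bounded_linear_Re_c0: "bounded_linear Re_c0"
proof (rule bounded_linear_intro[where K = 1])
  show "norm (Re_c0 f) \<le> norm f * 1" for f :: "('a, complex) c0"
    by (rule norm_c0_le) (use norm_apply_c0_le[of f] abs_Re_le_cmod order_trans in fastforce)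
qed (auto intro!: c0_eqI)

lemma bounded_linear_Im_c0: "bounded_linear Im_c0"
proof (rule bounded_linear_intro[where K = 1])
  show "norm (Im_c0 f) \<le> norm f * 1" for f :: "('a, complex) c0"
    by (rule norm_c0_le) (use norm_apply_c0_le[of f] abs_Im_le_cmod order_trans in fastforce)
qed (auto intro!: c0_eqI)

lemma bounded_linear_complex_c0: "bounded_linear complex_c0"
proof (rule bounded_linear_intro[where K = 1])
  show "norm (complex_c0 f) \<le> norm f * 1" for f :: "('a, real) c0"
    by (rule norm_c0_le) (use norm_apply_c0_le[of f] in simp)
qed (auto intro!: c0_eqI simp: scaleR_conv_of_real)

lemma bounded_linear_scale_c0: "bounded_linear (scale_c0 (c :: 'k::real_normed_field))"
  by (rule bounded_linear_intro[where K = "norm c"])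
    (auto intro!: c0_eqI simp: norm_scale_c0 algebra_simps)

lemma c0_decompose: "f = complex_c0 (Re_c0 f) + \<i> *\<^sub>k complex_c0 (Im_c0 f)"
  by (rule c0_eqI) (simp add: complex_eq_iff)

text \<open>Both directions are continuity of linear maps: \<open>f\<close> is recovered from its
  two parts by \<open>c0_decompose\<close>. This is what compares a complex generator with a real
  one.\<close>

lemma tendsto_c0_iff:
  "(f \<longlongrightarrow> l) F \<longleftrightarrow> ((\<lambda>y. Re_c0 (f y)) \<longlongrightarrow> Re_c0 l) F \<and> ((\<lambda>y. Im_c0 (f y)) \<longlongrightarrow> Im_c0 l) F"
  (is "_ \<longleftrightarrow> ?R")
proof
  assume ?R
  then have "((\<lambda>y. complex_c0 (Re_c0 (f y)) + \<i> *\<^sub>k complex_c0 (Im_c0 (f y))) \<longlongrightarrow>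
      complex_c0 (Re_c0 l) + \<i> *\<^sub>k complex_c0 (Im_c0 l)) F"
    by (intro tendsto_add bounded_linear.tendsto[OF bounded_linear_complex_c0]
        bounded_linear.tendsto[OF bounded_linear_scale_c0]) auto
  then show "(f \<longlongrightarrow> l) F" by (simp flip: c0_decompose)
qed (auto intro: bounded_linear.tendsto[OF bounded_linear_Re_c0] bounded_linear.tendsto[OF bounded_linear_Im_c0])

text \<open>Soft thresholding: approximates \<open>g\<close> by functions with compact support inside
  \<open>{x. g x \<noteq> 0}\<close>. The defining formula is only used for \<open>e \<ge> 0\<close>.\<close>

definition shrink_c0 :: "real \<Rightarrow> ('a::topological_space, real) c0 \<Rightarrow> ('a, real) c0" where
  "shrink_c0 e g = (SOME h. \<forall>x. apply_c0 h x = apply_c0 g x - max (- e) (min e (apply_c0 g x)))"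

lemma apply_shrink_c0:
  assumes "0 \<le> e"
  shows "apply_c0 (shrink_c0 e g) x = apply_c0 g x - max (- e) (min e (apply_c0 g x))"
proof -
  have "\<exists>h. \<forall>x. apply_c0 h x = apply_c0 g x - max (- e) (min e (apply_c0 g x))"
    by (rule apply_c0_surj_dominated[of "\<lambda>x. apply_c0 g x - max (- e) (min e (apply_c0 g x))" g])
      (use assms in \<open>auto intro!: continuous_intros\<close>)
  from someI_ex[OF this] show ?thesis unfolding shrink_c0_def by blast
qed

text \<open>The thresholded function lives on \<open>S = {x. e \<le> \<bar>g x\<bar>}\<close>, which
  is closed and contained in a compact set. On \<open>S\<close> the function \<open>u\<close> has no
  zero, hence a positive lower bound \<open>d\<close>.\<close>

lemma shrink_c0_dominated:
  assumes e: "0 < e" and u: "\<And>x. 0 \<le> apply_c0 u x"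
    and ug: "\<And>x. apply_c0 u x = 0 \<Longrightarrow> apply_c0 g x = 0"
  obtains C where "0 < C" "\<And>x. \<bar>apply_c0 (shrink_c0 e g) x\<bar> \<le> C * apply_c0 u x"
proof -
  define S where "S = {x. e \<le> \<bar>apply_c0 g x\<bar>}"
  obtain K where K: "compact K" "\<And>x. x \<notin> K \<Longrightarrow> norm (apply_c0 g x) < e"
    using vanishes_at_infinity_apply_c0[of g] e unfolding vanishes_at_infinity_def by blast
  have "closed S" unfolding S_def by (intro closed_Collect_le continuous_intros)
  moreover have "S = K \<inter> S" using K(2) by (fastforce simp: S_def)
  ultimately have S: "compact S" using compact_Int_closed[OF K(1)] by metis
  obtain d where d: "0 < d" "\<And>x. x \<in> S \<Longrightarrow> d \<le> apply_c0 u x"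
  proof (cases "S = {}")
    case False
    then obtain y where y: "y \<in> S" "\<And>x. x \<in> S \<Longrightarrow> apply_c0 u y \<le> apply_c0 u x"
      using continuous_attains_inf[OF S, of "apply_c0 u"] continuous_on_apply_c0 by blast
    have "apply_c0 u y \<noteq> 0" using ug[of y] y(1) e by (auto simp: S_def)
    then have "0 < apply_c0 u y" using u[of y] by simp
    with y that show ?thesis by blast
  qed (use that[of 1] in auto)
  show ?thesis
  \<comment> \<open>The summand \<open>1\<close> keeps the constant positive when
    \<open>g = 0\<close>.\<close>
  proof (rule that[of "(norm g + 1) / d"])
    show "0 < (norm g + 1) / d" using d(1) norm_ge_zero[of g] by (intro divide_pos_pos) linarith+
    fix x
    show "\<bar>apply_c0 (shrink_c0 e g) x\<bar> \<le> (norm g + 1) / d * apply_c0 u x"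
    proof (cases "x \<in> S")
      case True
      have "\<bar>apply_c0 (shrink_c0 e g) x\<bar> \<le> \<bar>apply_c0 g x\<bar>" using e by (auto simp: apply_shrink_c0)
      also have "\<dots> \<le> (norm g + 1) / d * d" using norm_apply_c0_le[of g x] d(1) by simp
      also have "\<dots> \<le> (norm g + 1) / d * apply_c0 u x"
        using d True by (intro mult_left_mono) auto
      finally show ?thesis .
    next
      case False
      then have "apply_c0 (shrink_c0 e g) x = 0" using e by (auto simp: apply_shrink_c0 S_def)
      then show ?thesis using u[of x] d(1) by simp
    qed
  qed
qed

lemma shrink_c0_tendsto: "(\<lambda>n. shrink_c0 (1 / real (Suc n)) g) \<longlonglongrightarrow> g"
proof (rule LIM_zero_cancel, rule tendsto_0_le[where K = 1])
  show "(\<lambda>n. 1 / real (Suc n)) \<longlonglongrightarrow> 0" by (rule LIMSEQ_Suc[OF lim_1_over_n])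
  show "\<forall>\<^sub>F n in sequentially. norm (shrink_c0 (1 / real (Suc n)) g - g) \<le> norm (1 / real (Suc n)) * 1"
    by (intro always_eventually allI norm_c0_le) (auto simp: apply_shrink_c0 abs_le_iff)
qed

text \<open>Locally compact Hausdorff spaces are completely regular: separate \<open>x\<close> from
  the complement of a neighbourhood \<open>U\<close> contained in a compact set, and subtract the
  separating function from \<open>1\<close>.\<close>

lemma bump_c0:
  fixes x :: "'a::t2_space"
  assumes "locally_compact_space (euclidean :: 'a topology)"
  obtains g :: "('a, real) c0" where "apply_c0 g x = 1" "\<And>y. 0 \<le> apply_c0 g y"
proof -
  have hd: "Hausdorff_space (euclidean :: 'a topology)"
    unfolding Hausdorff_space_def disjnt_def by (metis hausdorff open_openin)
  then have "completely_regular_space (euclidean :: 'a topology)"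
    using locally_compact_regular_imp_completely_regular_space assms by blast
  moreover obtain U K where UK: "open U" "compact K" "x \<in> U" "U \<subseteq> K"
    using assms by (auto simp: locally_compact_space_def) blast
  ultimately obtain f where f: "continuous_map euclidean (top_of_set {0..1::real}) f" "f x = 0"
      "f ` (- U) \<subseteq> {1}"
    unfolding completely_regular_space_def
    by (metis Compl_iff Diff_iff UNIV_I closed_Compl closed_closedin topspace_euclidean)
  have cont: "continuous_on UNIV f" and rng: "\<And>y. f y \<in> {0..1}"
    using f(1) by (auto simp: continuous_map_in_subtopology image_subset_iff)
  have van: "vanishes_at_infinity (\<lambda>y. 1 - f y)"
  proof -
    have "f y = 1" if "y \<notin> K" for y using that UK(4) f(3) by auto
    then show ?thesis
      unfolding vanishes_at_infinity_def using UK(2) by (auto intro!: exI[of _ K])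
  qed
  have "continuous_on UNIV (\<lambda>y. 1 - f y)" using cont by (intro continuous_intros)
  from apply_c0_surj[OF this van] obtain g where g: "\<And>y. apply_c0 g y = 1 - f y" by blast
  show ?thesis by (rule that[of g]) (use g f(2) rng in auto)
qed

section \<open>Individual eventual positivity and irreducibility\<close>

text \<open>Common ground for real and complex scalars. Irreducibility is stated for the closed
  ideals of functions vanishing on a set \<open>Z\<close>, and \<open>bump\<close> carries the local
  compactness of the underlying space.\<close>

locale irreducible_semigroup = sc_semigroup T
  for T :: "real \<Rightarrow> ('a::topological_space, real) c0 \<Rightarrow> ('a, real) c0" +
  assumes eventually_pos:
      "(\<And>x. 0 \<le> apply_c0 f x) \<Longrightarrow> \<exists>t0\<ge>0. \<forall>t\<ge>t0. \<forall>x. 0 \<le> apply_c0 (T t f) x"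
    and irreducible:
      "0 \<le> t0 \<Longrightarrow>
       (\<And>t g x. t0 \<le> t \<Longrightarrow> (\<And>y. y \<in> Z \<Longrightarrow> apply_c0 g y = 0) \<Longrightarrow> x \<in> Z \<Longrightarrow> apply_c0 (T t g) x = 0) \<Longrightarrow>
       (\<forall>g :: ('a, real) c0. (\<forall>y\<in>Z. apply_c0 g y = 0) \<longrightarrow> g = 0) \<or>
       (\<forall>g :: ('a, real) c0. \<forall>y\<in>Z. apply_c0 g y = 0)"
    and bump: "\<exists>g :: ('a, real) c0. apply_c0 g x = 1 \<and> (\<forall>y. 0 \<le> apply_c0 g y)"
begin

text \<open>Eventual positivity gives a time that depends on \<open>g\<close>. Baire's theorem makes
  the time common to all \<open>g\<close> dominated by a multiple of \<open>u\<close>, at the price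
  of the factor \<open>K\<close>.\<close>

lemma uniform_domination:
  assumes u: "\<And>x. 0 \<le> apply_c0 u x"
  obtains n K where "0 \<le> n"
    "\<And>C g t x. 0 < C \<Longrightarrow> (\<And>y. \<bar>apply_c0 g y\<bar> \<le> C * apply_c0 u y) \<Longrightarrow> n \<le> t \<Longrightarrow>
      \<bar>apply_c0 (T t g) x\<bar> \<le> C * K * apply_c0 (T t u) x"
proof -
  define S where "S = {g. \<forall>x. \<bar>apply_c0 g x\<bar> \<le> apply_c0 u x}"
  define V where "V n = (\<Inter>t\<in>{real n..}. \<Inter>x. {g. \<bar>apply_c0 (T t g) x\<bar> \<le> apply_c0 (T t u) x})" for n
  have "closed S" unfolding S_def
    by (intro closed_Collect_all closed_Collect_le continuous_intros
        linear_continuous_on bounded_linear_apply_c0)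
  moreover have "0 \<in> S" using u by (simp add: S_def)
  moreover have "closed (V n)" for n unfolding V_def
    by (intro closed_INT ballI closed_Collect_le continuous_intros
        bounded_linear.continuous_on[OF bounded_linear_apply_c0] continuous_on_T) auto
  moreover have "S \<subseteq> (\<Union>n. V n)"
  proof
    \<comment> \<open>\<open>\<bar>g\<bar> \<le> u\<close> means that \<open>u + g\<close> and
      \<open>u - g\<close> are both nonnegative; past the later of their two times \<open>g\<close>
      satisfies the inequality in \<open>V n\<close>.\<close>
    fix g assume g: "g \<in> S"
    have "0 \<le> apply_c0 (u + g) x" "0 \<le> apply_c0 (u - g) x" for x
      using g by (auto simp: S_def abs_le_iff dest!: spec[of _ x])
    then obtain t1 t2 where t: "0 \<le> t1" "\<And>t x. t \<ge> t1 \<Longrightarrow> 0 \<le> apply_c0 (T t (u + g)) x"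
        "\<And>t x. t \<ge> t2 \<Longrightarrow> 0 \<le> apply_c0 (T t (u - g)) x"
      using eventually_pos[of "u + g"] eventually_pos[of "u - g"] by metis
    obtain n where n: "max t1 t2 < real n" using reals_Archimedean2 by blast
    have "\<bar>apply_c0 (T t g) x\<bar> \<le> apply_c0 (T t u) x" if "real n \<le> t" for t x
    proof -
      have "0 \<le> t" using that by linarith
      then show ?thesis using t(2)[of t x] t(3)[of t x] that n by auto
    qed
    then have "g \<in> V n" by (auto simp: V_def)
    then show "g \<in> (\<Union>n. V n)" by blast
  qed
  ultimately have "\<exists>n. \<exists>x\<in>S. \<exists>e>0. \<forall>y\<in>S. dist y x < e \<longrightarrow> y \<in> V n"
    by (intro Baire_closed_cover) auto
  then obtain n g0 e where g0: "g0 \<in> S" "e > 0" "\<And>y. y \<in> S \<Longrightarrow> dist y g0 < e \<Longrightarrow> y \<in> V n"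
    by blast
  \<comment> \<open>\<open>d \<le> 1\<close> keeps \<open>g0 + d (g - g0)\<close> in the convex set
    \<open>S\<close>. As \<open>norm (g - g0) \<le> 2 * norm u\<close>, this point is also within
    \<open>e\<close> of \<open>g0\<close>. The summand \<open>1\<close> covers
    \<open>u = 0\<close>.\<close>
  define d where "d = min 1 (e / (2 * norm u + 1))"
  have d: "0 < d" "d \<le> 1" "d * (2 * norm u) < e"
  proof -
    show "0 < d" using g0 by (auto simp: d_def add_nonneg_pos)
    have "d * (2 * norm u) < d * (2 * norm u + 1)" using \<open>0 < d\<close> by simp
    also have "\<dots> \<le> e / (2 * norm u + 1) * (2 * norm u + 1)"
      by (intro mult_right_mono) (auto simp: d_def)
    also have "\<dots> = e" by (auto simp: add_nonneg_eq_0_iff)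
    finally show "d * (2 * norm u) < e" .
  qed (auto simp: d_def)
  have unit: "\<bar>apply_c0 (T t g) x\<bar> \<le> (2 / d + 1) * apply_c0 (T t u) x" if g: "g \<in> S" and t: "real n \<le> t" for g t x
  proof -
    define y where "y = g0 + d *\<^sub>R (g - g0)"
    have "\<bar>apply_c0 y x\<bar> \<le> apply_c0 u x" for x
    proof -
      have "apply_c0 y x = (1 - d) * apply_c0 g0 x + d * apply_c0 g x"
        by (simp add: y_def algebra_simps)
      also have "\<bar>\<dots>\<bar> \<le> (1 - d) * \<bar>apply_c0 g0 x\<bar> + d * \<bar>apply_c0 g x\<bar>"
        using d by (intro order_trans[OF abs_triangle_ineq]) (auto simp: abs_mult)
      also have "\<dots> \<le> (1 - d) * apply_c0 u x + d * apply_c0 u x"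
        using g g0(1) d by (intro add_mono mult_left_mono) (auto simp: S_def)
      finally show ?thesis by (simp add: algebra_simps)
    qed
    then have "y \<in> S" by (simp add: S_def)
    have Su: "norm h \<le> norm u" if "h \<in> S" for h
    proof (rule norm_c0_le)
      fix x
      show "norm (apply_c0 h x) \<le> norm u"
        using that norm_apply_c0_le[of u x] u[of x] by (auto simp: S_def dest!: spec[of _ x])
    qed
    have "norm (g - g0) \<le> 2 * norm u"
      using norm_triangle_ineq4[of g g0] Su[OF g] Su[OF g0(1)] by linarith
    then have "dist y g0 \<le> d * (2 * norm u)" using d by (simp add: y_def dist_norm)
    then have "y \<in> V n" "g0 \<in> V n" using g0 d \<open>y \<in> S\<close> by auto
    then have b: "\<bar>apply_c0 (T t y) x\<bar> \<le> apply_c0 (T t u) x" "\<bar>apply_c0 (T t g0) x\<bar> \<le> apply_c0 (T t u) x"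
      using t by (auto simp: V_def)
    have "0 \<le> t" using t by linarith
    then have "apply_c0 (T t y) x = apply_c0 (T t g0) x + d * (apply_c0 (T t g) x - apply_c0 (T t g0) x)"
      by (simp add: y_def)
    \<comment> \<open>Both \<open>y\<close> and \<open>g0\<close> lie in \<open>V n\<close>; solving
      for \<open>T t g\<close> turns their bounds into the constant
      \<open>2 / d + 1\<close>.\<close>
    then have "apply_c0 (T t g) x = (apply_c0 (T t y) x - apply_c0 (T t g0) x) / d + apply_c0 (T t g0) x"
      using d by simp
    also have "\<bar>\<dots>\<bar> \<le> 2 * apply_c0 (T t u) x / d + apply_c0 (T t u) x"
      using b d by (intro order_trans[OF abs_triangle_ineq] add_mono) (auto simp: divide_right_mono)
    finally show ?thesis by (simp add: algebra_simps)
  qed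
  show ?thesis
  proof (rule that[of "real n" "2 / d + 1"])
    fix C :: real and g t x
    assume C: "0 < C" and g: "\<And>y. \<bar>apply_c0 g y\<bar> \<le> C * apply_c0 u y" and t: "real n \<le> t"
    have "(1 / C) *\<^sub>R g \<in> S"
      using C g by (auto simp: S_def abs_mult pos_divide_le_eq mult.commute)
    from unit[OF this t, of x] have "\<bar>apply_c0 (T t g) x\<bar> / C \<le> (2 / d + 1) * apply_c0 (T t u) x"
      using C t by (simp add: abs_mult)
    then show "\<bar>apply_c0 (T t g) x\<bar> \<le> C * (2 / d + 1) * apply_c0 (T t u) x"
      using C by (simp add: pos_divide_le_eq mult_ac)
  qed auto
qed

text \<open>Among the functions vanishing on the zero set of \<open>u\<close>, those dominated by a
  multiple of \<open>u\<close> are dense: soft thresholding provides the approximants. So the closed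
  ideal generated by \<open>u\<close> consists of all functions vanishing where \<open>u\<close>
  does.\<close>

lemma vanish_by_density:
  assumes u: "\<And>x. 0 \<le> apply_c0 u x" and g: "\<And>y. apply_c0 u y = 0 \<Longrightarrow> apply_c0 g y = 0"
    and t: "0 \<le> t"
    and van: "\<And>h C. 0 < C \<Longrightarrow> (\<And>y. \<bar>apply_c0 h y\<bar> \<le> C * apply_c0 u y) \<Longrightarrow> apply_c0 (T t h) x = 0"
  shows "apply_c0 (T t g) x = 0"
proof -
  have "apply_c0 (T t (shrink_c0 (1 / real (Suc n)) g)) x = 0" for n
  proof -
    obtain C where "0 < C" "\<And>x. \<bar>apply_c0 (shrink_c0 (1 / real (Suc n)) g) x\<bar> \<le> C * apply_c0 u x"
      using shrink_c0_dominated[of "1 / real (Suc n)" u g] u g by auto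
    then show ?thesis by (rule van)
  qed
  moreover have "(\<lambda>n. apply_c0 (T t (shrink_c0 (1 / real (Suc n)) g)) x) \<longlonglongrightarrow> apply_c0 (T t g) x"
    by (intro tendsto_apply_c0 tendsto_T t shrink_c0_tendsto)
  ultimately show ?thesis using LIMSEQ_unique tendsto_const by (metis (no_types, lifting) ext)
qed

text \<open>By density, \<open>inv\<close> makes the ideal of functions vanishing on
  \<open>Z\<close> eventually invariant. If that ideal is zero then so is its member
  \<open>u\<close>; if it is everything, bump functions show that \<open>Z\<close> is empty.\<close>

lemma zero_or_strictly_positive:
  assumes u: "\<And>x. 0 \<le> apply_c0 u x" and t0: "0 \<le> t0"
    and inv: "\<And>t h C x. t0 \<le> t \<Longrightarrow> 0 < C \<Longrightarrow> (\<And>y. \<bar>apply_c0 h y\<bar> \<le> C * apply_c0 u y) \<Longrightarrow>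
      apply_c0 u x = 0 \<Longrightarrow> apply_c0 (T t h) x = 0"
  shows "u = 0 \<or> (\<forall>x. 0 < apply_c0 u x)"
proof -
  define Z where "Z = {x. apply_c0 u x = 0}"
  have "apply_c0 (T t g) x = 0"
    if "t0 \<le> t" "\<And>y. y \<in> Z \<Longrightarrow> apply_c0 g y = 0" "x \<in> Z" for t g x
    by (rule vanish_by_density[OF u]) (use that t0 inv in \<open>auto simp: Z_def\<close>)
  from irreducible[OF t0 this] show ?thesis
  proof
    assume "\<forall>g :: ('a, real) c0. (\<forall>y\<in>Z. apply_c0 g y = 0) \<longrightarrow> g = 0"
    then show ?thesis by (simp add: Z_def)
  next
    assume a: "\<forall>g :: ('a, real) c0. \<forall>y\<in>Z. apply_c0 g y = 0"
    have "0 < apply_c0 u x" for x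
    proof -
      obtain g :: "('a, real) c0" where "apply_c0 g x = 1" using bump by blast
      then have "x \<notin> Z" using a by (metis zero_neq_one)
      then show ?thesis using u[of x] by (simp add: Z_def)
    qed
    then show ?thesis by blast
  qed
qed

text \<open>If \<open>T t f = 0\<close> for some \<open>t\<close>, the semigroup would be nilpotent, so all closed ideals would
  eventually be invariant. Then \<open>L\<close> is a single point, where a nilpotent semigroup cannot be
  strongly continuous.\<close>

lemma orbit_nonzero:
  assumes f: "\<And>x. 0 \<le> apply_c0 f x" "f \<noteq> 0" and t1: "0 \<le> t1"
  shows "T t1 f \<noteq> 0"
proof
  assume "T t1 f = 0"
  then have late: "T t f = 0" if "t1 \<le> t" for t
    using T_add[of "t - t1" t1 f] that t1 by simp
  obtain n K where n: "0 \<le> n"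
    "\<And>C g t x. 0 < C \<Longrightarrow> (\<And>y. \<bar>apply_c0 g y\<bar> \<le> C * apply_c0 f y) \<Longrightarrow> n \<le> t \<Longrightarrow>
      \<bar>apply_c0 (T t g) x\<bar> \<le> C * K * apply_c0 (T t f) x"
    using uniform_domination[OF f(1)] by blast
  define N where "N = max n t1"
  have N: "0 \<le> N" using t1 by (simp add: N_def)
  \<comment> \<open>Domination by \<open>T t f = 0\<close> annihilates whatever lies below a
    multiple of \<open>f\<close>.\<close>
  have kill: "apply_c0 (T t h) x = 0"
    if "N \<le> t" "0 < C" "\<And>y. \<bar>apply_c0 h y\<bar> \<le> C * apply_c0 f y" for t h C x
    using n(2)[OF that(2,3), of t x] late[of t] that(1) by (simp add: N_def)
  have fpos: "0 < apply_c0 f x" for x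
    using zero_or_strictly_positive[OF f(1) N] kill f(2) by blast
  have nil: "T t g = 0" if "N \<le> t" for t g
  proof (rule c0_eqI)
    fix x
    have "apply_c0 (T t g) x = 0"
      by (rule vanish_by_density[OF f(1)]) (use fpos kill that N in \<open>auto simp: less_le\<close>)
    then show "apply_c0 (T t g) x = apply_c0 0 x" by simp
  qed
  define x0 :: 'a where "x0 = undefined"
  obtain e :: "('a, real) c0" where e: "apply_c0 e x0 = 1" using bump by blast
  \<comment> \<open>From time \<open>N\<close> on all operators are zero, so the ideal of functions
    vanishing at \<open>x0\<close> is eventually invariant. It does not contain \<open>e\<close>,
    hence it is \<open>{0}\<close>, and \<open>e\<close> spans the space.\<close>
  have "(\<forall>g :: ('a, real) c0. (\<forall>y\<in>{x0}. apply_c0 g y = 0) \<longrightarrow> g = 0) \<or>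
      (\<forall>g :: ('a, real) c0. \<forall>y\<in>{x0}. apply_c0 g y = 0)"
    by (rule irreducible[OF N]) (simp add: nil)
  moreover have "\<not> (\<forall>g :: ('a, real) c0. \<forall>y\<in>{x0}. apply_c0 g y = 0)"
    using e by (auto intro: exI[of _ e])
  ultimately have one_pt: "g = 0" if "apply_c0 g x0 = 0" for g :: "('a, real) c0"
    using that by blast
  obtain d where d: "d > 0" "\<And>h. 0 \<le> h \<Longrightarrow> h < d \<Longrightarrow> norm (T h e - e) < 1"
    using near_0[of 1 e] by auto
  define h where "h = d / 2"
  define a where "a = apply_c0 (T h e) x0"
  have h: "0 < h" using d by (simp add: h_def)
  have "\<bar>a - 1\<bar> < 1"
    using norm_apply_c0_le[of "T h e - e" x0] d(2)[of h] h d(1) e by (simp add: h_def a_def)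
  then have a: "a \<noteq> 0" by auto
  \<comment> \<open>On the span of \<open>e\<close> the operator \<open>T h\<close> is
    multiplication by \<open>a\<close>, nonzero because \<open>h\<close> is small; its powers cannot
    vanish.\<close>
  have he: "T h e = a *\<^sub>R e"
    using one_pt[of "T h e - a *\<^sub>R e"] e by (simp add: a_def)
  have "T (real k * h) e = a ^ k *\<^sub>R e" for k
  proof (induction k)
    case (Suc k)
    have "T (real (Suc k) * h) e = T (real k * h) (T h e)"
      using h by (simp add: T_add[symmetric] algebra_simps)
    also have "\<dots> = a *\<^sub>R a ^ k *\<^sub>R e" using Suc h he by simp
    finally show ?case by simp
  qed (simp add: T_0)
  moreover obtain k where "N / h < real k" using reals_Archimedean2 by blast
  then have "N \<le> real k * h" using h by (simp add: field_simps)
  ultimately have "a ^ k *\<^sub>R e = 0" using nil by metis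
  have "a ^ k = apply_c0 (a ^ k *\<^sub>R e) x0" using e by simp
  also have "\<dots> = 0" by (simp only: \<open>a ^ k *\<^sub>R e = 0\<close> apply_c0_simps)
  finally show False using a by simp
qed

end

section \<open>Resolvents defined on the whole plane\<close>

lemma bounded_operator_scale: "bounded_operator S \<Longrightarrow> S (c *\<^sub>k f) = c *\<^sub>k S f"
  unfolding bounded_operator_def by (simp add: linear_iff module_hom_iff Vector_Spaces.linear_def)

lemma bounded_operator_linear:
  assumes "bounded_operator S"
  shows "S (f + g) = S f + S g" "S (f - g) = S f - S g" "S 0 = 0"
  using assms unfolding bounded_operator_def
  by (simp_all add: bounded_linear.linear linear_add linear_diff linear_0)

text \<open>A pseudo-resolvent indexed by the whole plane, as an empty spectrum would provide. The
  power series argument works from these two properties.\<close>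

locale entire_resolvent =
  fixes R :: "complex \<Rightarrow> ('a::topological_space, complex) c0 \<Rightarrow> ('a, complex) c0"
  assumes bounded_operator_R: "bounded_operator (R \<mu>)"
    and resolvent_identity: "R \<mu> g - R \<nu> g = (\<nu> - \<mu>) *\<^sub>k R \<mu> (R \<nu> g)"
begin

lemmas R_lin [simp] = bounded_operator_linear[OF bounded_operator_R] bounded_operator_scale[OF bounded_operator_R]

lemma R_bound: obtains K where "K > 0" "\<And>g. norm (R \<nu> g) \<le> K * norm g"
  using bounded_operator_R[of \<nu>] bounded_linear.pos_bounded[of "R \<nu>"]
  unfolding bounded_operator_def by (metis mult.commute)

text \<open>The resolvent identity is used with \<open>R \<nu>\<close> outermost, so that the fixed
  bound \<open>K\<close> applies. The factor \<open>norm (R \<mu> g)\<close> left on the right is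
  absorbed for \<open>\<mu>\<close> close to \<open>\<nu>\<close>, where it is at most
  \<open>2 * norm (R \<nu> g)\<close>.\<close>

lemma R_tendsto: "((\<lambda>\<mu>. R \<mu> g) \<longlongrightarrow> R \<nu> g) (at \<nu>)"
proof -
  obtain K where K: "K > 0" "\<And>g. norm (R \<nu> g) \<le> K * norm g" using R_bound by blast
  have diff: "norm (R \<mu> g - R \<nu> g) \<le> norm (\<mu> - \<nu>) * (K * norm (R \<mu> g))" for \<mu>
  proof -
    have "norm (R \<mu> g - R \<nu> g) = norm (R \<nu> g - R \<mu> g)" by (rule norm_minus_commute)
    also have "\<dots> = norm (\<mu> - \<nu>) * norm (R \<nu> (R \<mu> g))"
      by (simp only: resolvent_identity norm_scale_c0)
    also have "\<dots> \<le> norm (\<mu> - \<nu>) * (K * norm (R \<mu> g))" by (intro mult_left_mono K) auto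
    finally show ?thesis .
  qed
  have near: "norm (R \<mu> g) \<le> 2 * norm (R \<nu> g)" if "norm (\<mu> - \<nu>) < 1 / (2 * K)" for \<mu>
  proof -
    have "norm (\<mu> - \<nu>) * K \<le> 1 / 2" using that K by (simp add: field_simps)
    then have "norm (\<mu> - \<nu>) * K * norm (R \<mu> g) \<le> 1 / 2 * norm (R \<mu> g)"
      by (rule mult_right_mono) simp
    then show ?thesis using diff[of \<mu>] norm_triangle_ineq2[of "R \<mu> g" "R \<nu> g"]
      by (simp add: mult.assoc)
  qed
  show ?thesis
  proof (rule LIM_zero_cancel, rule tendsto_0_le[where K = "K * (2 * norm (R \<nu> g))"])
    show "((\<lambda>\<mu>. \<mu> - \<nu>) \<longlongrightarrow> 0) (at \<nu>)" by (auto intro!: tendsto_eq_intros)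
    have "\<forall>\<^sub>F \<mu> in at \<nu>. dist \<mu> \<nu> < 1 / (2 * K)" unfolding eventually_at using K(1) by (intro exI[of _ "1 / (2 * K)"]) auto
    then show "\<forall>\<^sub>F \<mu> in at \<nu>. norm (R \<mu> g - R \<nu> g) \<le> norm (\<mu> - \<nu>) * (K * (2 * norm (R \<nu> g)))"
    proof eventually_elim
      case (elim \<mu>)
      have "norm (\<mu> - \<nu>) * (K * norm (R \<mu> g)) \<le> norm (\<mu> - \<nu>) * (K * (2 * norm (R \<nu> g)))"
        using near[of \<mu>] elim K(1) by (intro mult_left_mono) (auto simp: dist_norm)
      with diff[of \<mu>] show ?case by linarith
    qed
  qed
qed

text \<open>By the resolvent identity the difference quotient is exactly
  \<open>- R \<mu> (R \<nu> g)\<close> evaluated at \<open>x\<close>, and continuity in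
  \<open>\<mu>\<close> gives its limit.\<close>

lemma R_holomorphic: "(\<lambda>\<mu>. apply_c0 (R \<mu> g) x) holomorphic_on UNIV"
proof -
  have "((\<lambda>\<mu>. apply_c0 (R \<mu> g) x) has_field_derivative - apply_c0 (R \<nu> (R \<nu> g)) x) (at \<nu>)" for \<nu>
    unfolding has_field_derivative_iff
  proof (rule Lim_transform_eventually)
    show "((\<lambda>\<mu>. - apply_c0 (R \<mu> (R \<nu> g)) x) \<longlongrightarrow> - apply_c0 (R \<nu> (R \<nu> g)) x) (at \<nu>)"
      by (intro tendsto_minus tendsto_apply_c0 R_tendsto)
    have "- apply_c0 (R \<mu> (R \<nu> g)) x = (apply_c0 (R \<mu> g) x - apply_c0 (R \<nu> g) x) / (\<mu> - \<nu>)"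
      if "\<mu> \<noteq> \<nu>" for \<mu>
    proof -
      have "apply_c0 (R \<mu> g) x - apply_c0 (R \<nu> g) x = (\<nu> - \<mu>) * apply_c0 (R \<mu> (R \<nu> g)) x"
        using arg_cong[OF resolvent_identity[of \<mu> g \<nu>], of "\<lambda>f. apply_c0 f x"] by simp
      then show ?thesis using that by (simp add: divide_simps) (simp add: algebra_simps)
    qed
    then show "\<forall>\<^sub>F \<mu> in at \<nu>. - apply_c0 (R \<mu> (R \<nu> g)) x
        = (apply_c0 (R \<mu> g) x - apply_c0 (R \<nu> g) x) / (\<mu> - \<nu>)"
      by (auto simp: eventually_at_filter)
  qed
  then show ?thesis by (auto simp: holomorphic_on_def field_differentiable_def has_field_derivative_at_within)
qed

text \<open>Finite Neumann expansion with exact remainder, from iterating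
  \<open>R (l - z) = R l + z R (l - z) R l\<close>. It exhibits the Taylor coefficients without
  higher derivatives.\<close>

lemma R_expansion:
  "R (l - z) v = (\<Sum>k<n. z ^ k *\<^sub>k (R l ^^ Suc k) v) + z ^ n *\<^sub>k R (l - z) ((R l ^^ n) v)"
proof (induction n)
  case 0 then show ?case by (auto intro!: c0_eqI)
next
  case (Suc n)
  have step: "R (l - z) g = R l g + z *\<^sub>k R (l - z) (R l g)" for g
    using resolvent_identity[of "l - z" g l] by (simp add: algebra_simps)
  have "z ^ n *\<^sub>k R (l - z) ((R l ^^ n) v)
      = z ^ n *\<^sub>k (R l ^^ Suc n) v + z ^ Suc n *\<^sub>k R (l - z) ((R l ^^ Suc n) v)"
    by (subst step) (auto intro!: c0_eqI simp: algebra_simps)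
  then show ?case using Suc by (simp only: sum.lessThan_Suc add.assoc)
qed

text \<open>The Neumann series identifies the Taylor coefficients of the entire function
  \<open>F\<close> on a small disc. Its Taylor series then converges at every \<open>z\<close>, so
  the terms tend to \<open>0\<close>.\<close>

lemma R_powers_vanish: "(\<lambda>n. apply_c0 ((R l ^^ Suc n) v) x * z ^ n) \<longlonglongrightarrow> 0"
proof -
  define a where "a n = apply_c0 ((R l ^^ Suc n) v) x" for n
  define F where "F z = apply_c0 (R (l - z) v) x" for z
  have hol: "F holomorphic_on eball 0 \<infinity>"
  proof -
    have "(\<lambda>z. l - z) holomorphic_on UNIV" by (intro holomorphic_intros)
    from holomorphic_on_compose[OF this holomorphic_on_subset[OF R_holomorphic[of v x]]]
    show ?thesis by (simp add: F_def[abs_def] o_def)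
  qed
  obtain K where K: "K > 0" "\<And>g. norm (R l g) \<le> K * norm g" using R_bound by blast
  have pow: "norm ((R l ^^ n) v) \<le> K ^ n * norm v" for n
  proof (induction n)
    case (Suc n)
    have "norm ((R l ^^ Suc n) v) \<le> K * norm ((R l ^^ n) v)" using K by simp
    also have "\<dots> \<le> K * (K ^ n * norm v)" using Suc K by (intro mult_left_mono) auto
    finally show ?case by (simp add: mult_ac)
  qed simp
  have sums: "(\<lambda>n. a n * z ^ n) sums F z" if z: "norm z < 1 / K" for z
  proof -
    obtain K' where K': "K' > 0" "\<And>g. norm (R (l - z) g) \<le> K' * norm g" using R_bound by blast
    show ?thesis
      unfolding sums_def
    proof (rule LIM_zero_cancel, rule tendsto_0_le)
      have "norm z * K < 1" using z K by (simp add: field_simps)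
      then show "(\<lambda>n. (norm z * K) ^ n) \<longlonglongrightarrow> 0" using K by (intro LIMSEQ_power_zero) (auto simp: abs_mult)
      show "\<forall>\<^sub>F n in sequentially. norm ((\<Sum>k<n. a k * z ^ k) - F z) \<le> norm ((norm z * K) ^ n) * (K' * norm v)"
      proof (intro always_eventually allI)
        fix n
        have "F z = (\<Sum>k<n. a k * z ^ k) + z ^ n * apply_c0 (R (l - z) ((R l ^^ n) v)) x"
          unfolding F_def by (subst R_expansion[of l z v n]) (simp add: a_def apply_c0_sum mult.commute del: funpow.simps)
        then have "norm ((\<Sum>k<n. a k * z ^ k) - F z) = norm z ^ n * norm (apply_c0 (R (l - z) ((R l ^^ n) v)) x)"
          by (simp add: norm_mult norm_power)
        also have "\<dots> \<le> norm z ^ n * (K' * (K ^ n * norm v))"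
          using K'(2)[of "(R l ^^ n) v"] norm_apply_c0_le[of "R (l - z) ((R l ^^ n) v)" x]
            mult_left_mono[OF pow[of n] less_imp_le[OF K'(1)]]
          by (intro mult_left_mono) auto
        finally show "norm ((\<Sum>k<n. a k * z ^ k) - F z) \<le> norm ((norm z * K) ^ n) * (K' * norm v)"
          using K(1) by (simp add: power_mult_distrib mult_ac abs_mult)
      qed
    qed
  qed
  \<comment> \<open>Agreement near \<open>0\<close> fixes the formal power series; holomorphy on the
    whole plane makes its radius of convergence infinite.\<close>
  have "\<forall>\<^sub>F u in nhds 0. (\<lambda>n. fps_nth (Abs_fps a) n * u ^ n) sums F u"
    unfolding eventually_nhds_metric using K(1) sums by (intro exI[of _ "1 / K"]) auto
  then have "F has_fps_expansion Abs_fps a" by (rule has_fps_expansionI)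
  then have "fps_expansion F 0 = Abs_fps a" by (rule fps_expansion_eqI)
  then have "norm z < fps_conv_radius (Abs_fps a)"
    using conv_radius_fps_expansion[OF hol] by simp
  then have "summable (\<lambda>n. fps_nth (Abs_fps a) n * z ^ n)" by (rule summable_fps)
  then show ?thesis using summable_LIMSEQ_zero by (simp add: a_def)
qed

end

section \<open>Non-emptiness of the spectrum\<close>

lemma generator_zero:
  "(\<And>t. 0 < t \<Longrightarrow> T t 0 = 0) \<Longrightarrow> (0, 0) \<in> generator T"
  unfolding generator_def
  by (auto intro!: tendsto_eventually eventually_mono[OF eventually_at_right_less[of 0]])

lemma (in sc_semigroup) generator_diff:
  assumes "(g, h) \<in> generator T" "(g', h') \<in> generator T"
  shows "(g - g', h - h') \<in> generator T"
proof -
  have "((\<lambda>t. (T t g - g) /\<^sub>R t - (T t g' - g') /\<^sub>R t) \<longlongrightarrow> h - h') (at_right 0)"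
    using assms by (intro tendsto_diff) (auto simp: generator_def)
  moreover have "\<forall>\<^sub>F t in at_right 0.
      (T t g - g) /\<^sub>R t - (T t g' - g') /\<^sub>R t = (T t (g - g') - (g - g')) /\<^sub>R t"
    using eventually_at_right_less[of 0] by eventually_elim (simp add: algebra_simps)
  ultimately show ?thesis by (simp add: generator_def tendsto_cong)
qed

context irreducible_semigroup
begin

theorem spectrum_complexification_nonempty:
  "spectrum (complexification (generator T)) \<noteq> {}"
proof
  define A where "A = complexification (generator T)"
  assume "spectrum (complexification (generator T)) = {}"
  then have "\<mu> \<in> resolvent_set A" for \<mu>
    unfolding spectrum_def A_def by blast
  then have "\<exists>S. bounded_operator S \<and> (\<forall>g. (S g, \<mu> *\<^sub>k S g - g) \<in> A) \<and>
     (\<forall>(f, h)\<in>A. S (\<mu> *\<^sub>k f - h) = f)" for \<mu>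
    by (simp add: resolvent_set_def)
  then obtain R where R: "\<And>\<mu>. bounded_operator (R \<mu>) \<and> (\<forall>g. (R \<mu> g, \<mu> *\<^sub>k R \<mu> g - g) \<in> A) \<and>
     (\<forall>(f, h)\<in>A. R \<mu> (\<mu> *\<^sub>k f - h) = f)"
    by meson
  have bop: "bounded_operator (R \<mu>)" for \<mu> using R by blast
  have R_gen: "(R \<mu> g, \<mu> *\<^sub>k R \<mu> g - g) \<in> A" for \<mu> g using R by blast
  have R_inv: "R \<mu> (\<mu> *\<^sub>k f - h) = f" if "(f, h) \<in> A" for \<mu> f h using R that by blast
  interpret R: entire_resolvent R
  proof
    fix \<mu> \<nu> g
    \<comment> \<open>The resolvent identity: the left inverse \<open>R \<mu>\<close> is applied at
      the point of the graph supplied by \<open>R \<nu> g\<close>.\<close>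
    have "R \<mu> (\<mu> *\<^sub>k R \<nu> g - (\<nu> *\<^sub>k R \<nu> g - g)) = R \<nu> g" by (rule R_inv[OF R_gen])
    also have "\<mu> *\<^sub>k R \<nu> g - (\<nu> *\<^sub>k R \<nu> g - g) = g - (\<nu> - \<mu>) *\<^sub>k R \<nu> g"
      by (rule c0_eqI) (simp add: algebra_simps)
    finally show "R \<mu> g - R \<nu> g = (\<nu> - \<mu>) *\<^sub>k R \<mu> (R \<nu> g)"
      by (simp add: bounded_operator_linear[OF bop] bounded_operator_scale[OF bop] algebra_simps)
  qed (rule bop)

  \<comment> \<open>The resolvent on the real space\<close>
  obtain M w where growth: "\<And>t f. 0 \<le> t \<Longrightarrow> norm (T t f) \<le> M * exp (w * t) * norm f"
    using growth_bound by metis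
  define l where "l = w + 1"
  define L where "L = complex_of_real l"
  define Q where "Q v = Re_c0 (R L (complex_c0 v))" for v
  have A_complex: "(complex_c0 f, complex_c0 h) \<in> A" if "(f, h) \<in> generator T" for f h
    using that generator_zero[of T] by (auto simp: A_def complexification_def)
  have no_eigen: "h = 0" if "(h, l *\<^sub>R h) \<in> generator T" for h
  proof -
    have "R L (L *\<^sub>k complex_c0 h - complex_c0 (l *\<^sub>R h)) = complex_c0 h"
      by (rule R_inv[OF A_complex[OF that]])
    then have "complex_c0 h = 0" by (simp add: L_def)
    then show ?thesis by (metis Re_Im_complex_c0(1) complex_c0_simps(1))
  qed
  have Q_gen: "(Q v, l *\<^sub>R Q v - v) \<in> generator T" for v
    using R_gen[of L "complex_c0 v"]
    by (simp add: A_def complexification_def Q_def Re_Im_c0_simps L_def)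
  \<comment> \<open>As \<open>v\<close> is real and \<open>l\<close> is real, the imaginary part
    \<open>h\<close> solves \<open>A h = l h\<close>, so it vanishes: the resolvent at
    \<open>l\<close> preserves real functions.\<close>
  have "Im_c0 (R L (complex_c0 v)) = 0" for v
    by (rule no_eigen) (use R_gen[of L "complex_c0 v"] in
      \<open>simp add: A_def complexification_def Re_Im_c0_simps L_def\<close>)
  then have Q_complex: "complex_c0 (Q v) = R L (complex_c0 v)" for v
    by (simp add: Q_def complex_c0_Re)
  have Q_unique: "g = Q v" if "(g, l *\<^sub>R g - v) \<in> generator T" for g v
  proof -
    have "(g - Q v, l *\<^sub>R (g - Q v)) \<in> generator T"
      using generator_diff[OF that Q_gen[of v]] by (simp add: algebra_simps)
    then show ?thesis using no_eigen by fastforce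
  qed
  have Q_lin: "Q (f - g) = Q f - Q g" "Q (c *\<^sub>R f) = c *\<^sub>R Q f" for f g c
    by (simp_all add: Q_def Re_Im_c0_simps)
  \<comment> \<open>\<open>T t (Q v)\<close> solves the equation that determines
    \<open>Q (T t v)\<close>.\<close>
  have Q_T: "Q (T t v) = T t (Q v)" if "0 \<le> t" for t v
    by (rule Q_unique[symmetric]) (use generator_shift[OF Q_gen that] that in simp)
  have Qn_T: "(Q ^^ n) (T t v) = T t ((Q ^^ n) v)" if "0 \<le> t" for n t v
    by (induction n) (simp_all add: Q_T that)
  have Qn_lin: "(Q ^^ n) (f - g) = (Q ^^ n) f - (Q ^^ n) g" "(Q ^^ n) (c *\<^sub>R f) = c *\<^sub>R (Q ^^ n) f"
    for n f g c
    by (induction n) (simp_all add: Q_lin)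
  have Qn_complex: "complex_c0 ((Q ^^ n) v) = (R L ^^ n) (complex_c0 v)" for n v
    by (induction n) (simp_all add: Q_complex)

  \<comment> \<open>Vectors with positive orbit\<close>
  define pos where "pos v \<longleftrightarrow> (\<forall>s\<ge>0. \<forall>x. 0 \<le> apply_c0 (T s v) x)" for v
  have pos0: "0 \<le> apply_c0 v x" if "pos v" for v x
    using that unfolding pos_def by (metis T_0 order_refl)
  have pos_late: "\<exists>t1\<ge>0. \<forall>t\<ge>t1. pos (T t f)" if f: "\<And>x. 0 \<le> apply_c0 f x" for f
  proof -
    obtain t1 where "t1 \<ge> 0" "\<And>t x. t \<ge> t1 \<Longrightarrow> 0 \<le> apply_c0 (T t f) x"
      using eventually_pos[OF f] by blast
    then show ?thesis unfolding pos_def by (intro exI[of _ t1]) (simp flip: T_add)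
  qed
  \<comment> \<open>Positivity of the whole orbit, rather than of the vector alone, is the property
    that passes from \<open>v\<close> to \<open>Q v\<close>; the functionals are the point
    evaluations.\<close>
  have pos_Q: "pos (Q v)" if "pos v" for v
    unfolding pos_def
    by (intro allI impI resolvent_orbit_nonneg[OF growth _ Q_gen bounded_linear_apply_c0])
      (use that in \<open>auto simp: pos_def l_def\<close>)
  then have pos_Qn: "pos ((Q ^^ n) v)" if "pos v" for n v
    using that by (induction n) simp_all
  have T_Q_le: "apply_c0 (T t (Q v)) x \<le> exp (l * t) * apply_c0 (Q v) x" if "pos v" "0 \<le> t" for v t x
  proof -
    have "exp (- (l * t)) * apply_c0 (T t (Q v)) x \<le> exp (- (l * 0)) * apply_c0 (T 0 (Q v)) x"
      by (rule rescaled_orbit_antimono[OF Q_gen bounded_linear_apply_c0])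
        (use that in \<open>auto simp: pos_def\<close>)
    then show ?thesis by (simp add: T_0 exp_minus field_simps)
  qed

  \<comment> \<open>A strictly positive vector in the range of the resolvent\<close>
  obtain g :: "('a, real) c0" where g: "apply_c0 g undefined = 1" "\<And>y. 0 \<le> apply_c0 g y"
    using bump by blast
  \<comment> \<open>Thresholding gives \<open>f\<close> compact support, so that a strictly positive
    \<open>u\<close> will dominate it; \<open>undefined\<close> is an arbitrary point, where
    \<open>f\<close> keeps the value \<open>1 / 2\<close>.\<close>
  define f where "f = shrink_c0 (1 / 2) g"
  have f_pos: "0 \<le> apply_c0 f x" for x using g(2)[of x] by (auto simp: f_def apply_shrink_c0)
  have "apply_c0 f undefined = 1 / 2" using g(1) by (simp add: f_def apply_shrink_c0)
  then have f_nz: "f \<noteq> 0" by auto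
  obtain t0 where t0: "0 \<le> t0" "\<And>t. t0 \<le> t \<Longrightarrow> pos (T t f)" using pos_late[OF f_pos] by blast
  define u where "u = Q (T t0 f)"
  have u_pos: "pos u" using t0 by (simp add: u_def pos_Q)
  have "u \<noteq> 0"
  proof
    assume "u = 0"
    \<comment> \<open>\<open>Q\<close> is injective because the generator is single-valued: its
      value at \<open>0\<close> is \<open>0\<close>.\<close>
    then have "(0, - T t0 f) \<in> generator T" using Q_gen[of "T t0 f"] by (simp add: u_def)
    moreover have "(0, 0) \<in> generator T" by (rule generator_zero) simp
    ultimately have "- T t0 f = 0"
      unfolding generator_def mem_Collect_eq prod.case by (rule tendsto_unique[OF trivial_limit_at_right_real])
    then show False using orbit_nonzero[OF f_pos f_nz t0(1)] by simp
  qed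
  obtain n K where n: "0 \<le> n"
    "\<And>C h t x. 0 < C \<Longrightarrow> (\<And>y. \<bar>apply_c0 h y\<bar> \<le> C * apply_c0 u y) \<Longrightarrow> n \<le> t \<Longrightarrow>
      \<bar>apply_c0 (T t h) x\<bar> \<le> C * K * apply_c0 (T t u) x"
    using uniform_domination[OF pos0[OF u_pos]] by blast
  have u_strict: "0 < apply_c0 u x" for x
  proof -
    have "apply_c0 (T t h) x = 0" if t: "n \<le> t" and C: "0 < C"
      and h: "\<And>y. \<bar>apply_c0 h y\<bar> \<le> C * apply_c0 u y" and x: "apply_c0 u x = 0" for t h C x
    proof -
      have t': "0 \<le> t" using t n(1) by simp
      \<comment> \<open>At a zero \<open>x\<close> of \<open>u\<close>, \<open>T t u\<close> is
        squeezed between \<open>0\<close> and \<open>exp (l * t)\<close> times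
        \<open>u\<close>.\<close>
      then have "apply_c0 (T t u) x = 0"
        using T_Q_le[of "T t0 f" t x] t0 x u_pos by (auto simp: u_def pos_def intro!: antisym)
      then show ?thesis using n(2)[OF C h t, of x] by simp
    qed
    then show ?thesis using zero_or_strictly_positive[OF pos0[OF u_pos] n(1)] \<open>u \<noteq> 0\<close> by blast
  qed

  \<comment> \<open>Geometric lower bound for the powers of the resolvent\<close>
  obtain C where C: "0 < C" "\<And>x. \<bar>apply_c0 f x\<bar> \<le> C * apply_c0 u x"
    using shrink_c0_dominated[of "1 / 2" u g] pos0[OF u_pos] u_strict
    unfolding f_def by (metis half_gt_zero less_irrefl zero_less_one)
  define h where "h = C *\<^sub>R u - f"
  have "0 \<le> apply_c0 h x" for x using C(2)[of x] by (simp add: h_def)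
  then obtain t1 where t1: "0 \<le> t1" "\<And>t. t1 \<le> t \<Longrightarrow> pos (T t h)" using pos_late by blast
  \<comment> \<open>From time \<open>s\<close> on the orbits of \<open>f\<close> and of
    \<open>C u - f\<close> are both positive.\<close>
  define s where "s = max t0 t1"
  have s: "0 \<le> s" using t0 by (simp add: s_def)
  define v where "v = T s f"
  have v: "pos v" using t0 by (simp add: v_def s_def)
  have v_nz: "v \<noteq> 0" using orbit_nonzero[OF f_pos f_nz s] by (simp add: v_def)
  define c where "c = 1 / (C * exp (l * t0))"
  have c: "0 < c" using C by (simp add: c_def)
  \<comment> \<open>Positivity of \<open>Q^k (T s h)\<close> reads
    \<open>Q^k v \<le> C T t0 (Q^(k+1) v)\<close>. Removing \<open>T t0\<close> by
    \<open>T_Q_le\<close> costs \<open>exp (l * t0)\<close>; this explains \<open>c\<close>.\<close>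
  have step: "c * apply_c0 ((Q ^^ k) v) x \<le> apply_c0 ((Q ^^ Suc k) v) x" for k x
  proof -
    have Tu: "T s u = T t0 (Q v)"
      using s t0(1) by (simp add: u_def v_def Q_T flip: T_add) (simp add: add.commute)
    have "pos ((Q ^^ k) (T s h))" using t1 by (intro pos_Qn) (simp add: s_def)
    then have "0 \<le> apply_c0 ((Q ^^ k) (T s h)) x" by (rule pos0)
    also have "T s h = C *\<^sub>R T t0 (Q v) - v" using s by (simp add: h_def v_def Tu)
    also have "(Q ^^ k) \<dots> = C *\<^sub>R T t0 ((Q ^^ Suc k) v) - (Q ^^ k) v"
      using t0(1) by (simp add: Qn_lin Qn_T funpow_swap1)
    finally have "apply_c0 ((Q ^^ k) v) x \<le> C * apply_c0 (T t0 (Q ((Q ^^ k) v))) x" by simp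
    also have "\<dots> \<le> C * (exp (l * t0) * apply_c0 (Q ((Q ^^ k) v)) x)"
      using T_Q_le[OF pos_Qn[OF v] t0(1)] C(1) by (intro mult_left_mono) auto
    finally show ?thesis using C(1) by (simp add: c_def field_simps)
  qed
  have lower: "c ^ k * apply_c0 v x \<le> apply_c0 ((Q ^^ k) v) x" for k x
  proof (induction k)
    case (Suc k)
    have "c ^ Suc k * apply_c0 v x = c * (c ^ k * apply_c0 v x)" by simp
    also have "\<dots> \<le> c * apply_c0 ((Q ^^ k) v) x" using Suc c by (intro mult_left_mono) auto
    also have "\<dots> \<le> apply_c0 ((Q ^^ Suc k) v) x" by (rule step)
    finally show ?case .
  qed simp

  \<comment> \<open>Contradiction with the entire power series\<close>
  obtain x where "apply_c0 v x \<noteq> 0" using v_nz c0_eqI[of v 0] by auto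
  then have x: "0 < apply_c0 v x" using pos0[OF v, of x] by simp
  \<comment> \<open>At \<open>z = 1 / c\<close> the terms of the series stay above
    \<open>c * apply_c0 v x > 0\<close>, by the lower bound for exponent
    \<open>Suc k\<close>.\<close>
  have "(\<lambda>k. apply_c0 ((R L ^^ Suc k) (complex_c0 v)) x * of_real (1 / c) ^ k) \<longlonglongrightarrow> 0"
    by (rule R.R_powers_vanish)
  then have "(\<lambda>k. norm (apply_c0 ((R L ^^ Suc k) (complex_c0 v)) x * of_real (1 / c) ^ k)) \<longlonglongrightarrow> 0"
    by (rule tendsto_norm_zero)
  moreover have "c * apply_c0 v x \<le> norm (apply_c0 ((R L ^^ Suc k) (complex_c0 v)) x * of_real (1 / c) ^ k)" for k
  proof -
    have "c * apply_c0 v x = c ^ Suc k * apply_c0 v x * (1 / c) ^ k"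
      using c by (simp add: power_divide)
    also have "\<dots> \<le> apply_c0 ((Q ^^ Suc k) v) x * (1 / c) ^ k"
      using c by (intro mult_right_mono lower) auto
    also have "\<dots> \<le> norm (apply_c0 ((Q ^^ Suc k) v) x * (1 / c) ^ k)" by simp
    also have "\<dots> = norm (complex_of_real (apply_c0 ((Q ^^ Suc k) v) x * (1 / c) ^ k))" by (simp only: norm_of_real real_norm_def)
    also have "complex_of_real (apply_c0 ((Q ^^ Suc k) v) x * (1 / c) ^ k) =
        apply_c0 ((R L ^^ Suc k) (complex_c0 v)) x * of_real (1 / c) ^ k"
      unfolding Qn_complex[symmetric] by simp
    finally show ?thesis .
  qed
  ultimately have "c * apply_c0 v x \<le> 0"
    by (intro tendsto_lowerbound[OF _ always_eventually]) auto
  then show False using c x by (simp add: mult_le_0_iff)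
qed

end

section \<open>Real and complex semigroups as instances of the locale\<close>

lemma vanishing_ideal:
  "lattice_ideal {g :: ('a::topological_space, 'k::real_normed_field) c0. \<forall>y\<in>Z. apply_c0 g y = 0}"
proof -
  interpret vector_space "scale_c0 :: 'k \<Rightarrow> ('a, 'k) c0 \<Rightarrow> _" by (rule vector_space_scale_c0)
  show ?thesis
    unfolding lattice_ideal_def
    by (auto intro!: subspaceI) (metis norm_le_zero_iff norm_zero)
qed

lemma closed_vanishing_ideal:
  "closed {g :: ('a::topological_space, 'k::real_normed_field) c0. \<forall>y\<in>Z. apply_c0 g y = 0}"
  unfolding Ball_def
  by (intro closed_Collect_all closed_Collect_imp open_Collect_const closed_Collect_eq continuous_intros
      linear_continuous_on bounded_linear_apply_c0)

text \<open>Applies irreducibility to the closed ideal of functions vanishing on \<open>Z\<close>,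
  giving the form that the locale assumes.\<close>

lemma persistently_irreducibleD:
  fixes T :: "real \<Rightarrow> ('a::topological_space, 'k::real_normed_field) c0 \<Rightarrow> ('a, 'k) c0"
  assumes "persistently_irreducible T" "0 \<le> t0"
    and "\<And>t g x. t0 \<le> t \<Longrightarrow> (\<And>y. y \<in> Z \<Longrightarrow> apply_c0 g y = 0) \<Longrightarrow> x \<in> Z \<Longrightarrow> apply_c0 (T t g) x = 0"
  shows "(\<forall>g :: ('a, 'k) c0. (\<forall>y\<in>Z. apply_c0 g y = 0) \<longrightarrow> g = 0) \<or>
    (\<forall>g :: ('a, 'k) c0. \<forall>y\<in>Z. apply_c0 g y = 0)"
proof -
  let ?I = "{g :: ('a, 'k) c0. \<forall>y\<in>Z. apply_c0 g y = 0}"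
  have "uniformly_eventually_invariant T ?I"
    unfolding uniformly_eventually_invariant_def using assms(2,3) by (intro exI[of _ t0]) auto
  then have "?I = {0} \<or> ?I = UNIV"
    using assms(1) closed_vanishing_ideal vanishing_ideal
    unfolding persistently_irreducible_def by blast
  then show ?thesis by (auto simp: set_eq_iff)
qed

lemma irreducible_semigroup_real:
  fixes T :: "real \<Rightarrow> ('a::t2_space, real) c0 \<Rightarrow> ('a, real) c0"
  assumes lc: "locally_compact_space (euclidean :: 'a topology)"
    and T: "C0_semigroup T" "individually_eventually_positive T" "persistently_irreducible T"
  shows "irreducible_semigroup T"
proof (intro irreducible_semigroup.intro sc_semigroup.intro irreducible_semigroup_axioms.intro)
  show "bounded_linear (T t)" if "0 \<le> t" for t
    using T(1) that by (auto simp: C0_semigroup_def bounded_operator_def)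
  show "T 0 f = f" for f using T(1) by (simp add: C0_semigroup_def)
  show "T (s + t) f = T s (T t f)" if "0 \<le> s" "0 \<le> t" for s t f
    using T(1) that by (simp add: C0_semigroup_def)
  show "((\<lambda>t. T t f) \<longlongrightarrow> f) (at_right 0)" for f using T(1) by (simp add: C0_semigroup_def)
  have nn: "nonneg_c0 f \<longleftrightarrow> (\<forall>x. 0 \<le> apply_c0 f x)" for f :: "('a, real) c0"
    using nonneg_Reals_of_real_iff[where 'a = real] by (simp add: nonneg_c0_def)
  show "\<exists>t0\<ge>0. \<forall>t\<ge>t0. \<forall>x. 0 \<le> apply_c0 (T t f) x" if "\<And>x. 0 \<le> apply_c0 f x" for f
    using T(2) that unfolding individually_eventually_positive_def nn by blast
  show "\<exists>g :: ('a, real) c0. apply_c0 g x = 1 \<and> (\<forall>y. 0 \<le> apply_c0 g y)" for x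
    using bump_c0[OF lc, of x] by metis
qed (rule persistently_irreducibleD[OF T(3)], assumption, blast)

text \<open>For a real semigroup this is its restriction to the real functions: the image of a real
  function has no imaginary part, so \<open>Re_c0\<close> merely changes the type.\<close>

definition real_part_semigroup ::
  "(real \<Rightarrow> ('a::topological_space, complex) c0 \<Rightarrow> ('a, complex) c0) \<Rightarrow> real \<Rightarrow> ('a, real) c0 \<Rightarrow> ('a, real) c0" where
  "real_part_semigroup T t f = Re_c0 (T t (complex_c0 f))"

context
  fixes T :: "real \<Rightarrow> ('a::t2_space, complex) c0 \<Rightarrow> ('a, complex) c0"
  assumes C0: "C0_semigroup T" and real: "real_semigroup T"
begin

lemma complex_real_part_semigroup:
  assumes "0 \<le> t"
  shows "complex_c0 (real_part_semigroup T t f) = T t (complex_c0 f)"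
proof -
  have "real_c0 (complex_c0 f)" by (simp add: real_c0_def)
  then have "real_c0 (T t (complex_c0 f))" using real assms by (simp add: real_semigroup_def)
  then have "Im_c0 (T t (complex_c0 f)) = 0"
    by (intro c0_eqI) (simp add: real_c0_def complex_is_Real_iff)
  then show ?thesis by (simp add: real_part_semigroup_def complex_c0_Re)
qed

lemma Re_Im_semigroup:
  assumes "0 \<le> t"
  shows "Re_c0 (T t f) = real_part_semigroup T t (Re_c0 f)"
    "Im_c0 (T t f) = real_part_semigroup T t (Im_c0 f)"
proof -
  have bop: "bounded_operator (T t)" using C0 assms by (simp add: C0_semigroup_def)
  have "T t f = complex_c0 (real_part_semigroup T t (Re_c0 f)) +
      \<i> *\<^sub>k complex_c0 (real_part_semigroup T t (Im_c0 f))"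
    by (subst c0_decompose[of f])
      (simp only: bounded_operator_linear[OF bop] bounded_operator_scale[OF bop]
        complex_real_part_semigroup[OF assms])
  then show "Re_c0 (T t f) = real_part_semigroup T t (Re_c0 f)"
    "Im_c0 (T t f) = real_part_semigroup T t (Im_c0 f)"
    by (auto intro!: c0_eqI)
qed

text \<open>Difference quotients converge exactly when their real and imaginary parts do, and taking
  parts commutes with the semigroup. The complex case is thereby reduced to the real one.\<close>

lemma complexification_generator: "complexification (generator (real_part_semigroup T)) = generator T"
proof -
  have ev: "\<forall>\<^sub>F t in at_right 0. Re_c0 ((T t f - f) /\<^sub>R t) = (real_part_semigroup T t (Re_c0 f) - Re_c0 f) /\<^sub>R t"
    "\<forall>\<^sub>F t in at_right 0. Im_c0 ((T t f - f) /\<^sub>R t) = (real_part_semigroup T t (Im_c0 f) - Im_c0 f) /\<^sub>R t" for f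
    by (auto intro!: eventually_mono[OF eventually_at_right_less[of 0]] c0_eqI simp flip: Re_Im_semigroup)
  show ?thesis
    by (auto simp: complexification_def generator_def tendsto_c0_iff tendsto_cong[OF ev(1)] tendsto_cong[OF ev(2)])
qed

text \<open>Irreducibility transfers because a complex function vanishes on \<open>Z\<close> exactly
  when both its parts do: invariance is lifted to the complex ideal, and the resulting alternative
  is read off on real functions.\<close>

lemma irreducible_semigroup_real_part:
  assumes lc: "locally_compact_space (euclidean :: 'a topology)"
    and T: "individually_eventually_positive T" "persistently_irreducible T"
  shows "irreducible_semigroup (real_part_semigroup T)"
proof (intro irreducible_semigroup.intro sc_semigroup.intro irreducible_semigroup_axioms.intro)
  let ?T = "real_part_semigroup T"
  show "bounded_linear (?T t)" if "0 \<le> t" for t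
  proof -
    have "bounded_linear (T t)" using C0 that by (auto simp: C0_semigroup_def bounded_operator_def)
    from bounded_linear_compose[OF bounded_linear_Re_c0 bounded_linear_compose[OF this bounded_linear_complex_c0]]
    show ?thesis by (simp add: real_part_semigroup_def[abs_def] o_def)
  qed
  show "?T 0 f = f" for f using C0 by (simp add: C0_semigroup_def real_part_semigroup_def)
  show "?T (s + t) f = ?T s (?T t f)" if "0 \<le> s" "0 \<le> t" for s t f
    using C0 that complex_real_part_semigroup[OF that(2), of f]
    by (simp add: C0_semigroup_def real_part_semigroup_def)
  show "((\<lambda>t. ?T t f) \<longlongrightarrow> f) (at_right 0)" for f
  proof -
    have "((\<lambda>t. T t (complex_c0 f)) \<longlongrightarrow> complex_c0 f) (at_right 0)"
      using C0 by (simp add: C0_semigroup_def)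
    from bounded_linear.tendsto[OF bounded_linear_Re_c0 this]
    show ?thesis by (simp add: real_part_semigroup_def)
  qed
  show "\<exists>t0\<ge>0. \<forall>t\<ge>t0. \<forall>x. 0 \<le> apply_c0 (?T t f) x" if "\<And>x. 0 \<le> apply_c0 f x" for f
  proof -
    have "nonneg_c0 (complex_c0 f)" using that by (simp add: nonneg_c0_def)
    then obtain t0 where "t0 \<ge> 0" "\<And>t. t \<ge> t0 \<Longrightarrow> nonneg_c0 (T t (complex_c0 f))"
      using T(1) unfolding individually_eventually_positive_def by blast
    then show ?thesis
      by (auto intro!: exI[of _ t0] simp: nonneg_c0_def real_part_semigroup_def complex_nonneg_Reals_iff)
  qed
  show "\<exists>g :: ('a, real) c0. apply_c0 g x = 1 \<and> (\<forall>y. 0 \<le> apply_c0 g y)" for x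
    using bump_c0[OF lc, of x] by metis
  show "(\<forall>g :: ('a, real) c0. (\<forall>y\<in>Z. apply_c0 g y = 0) \<longrightarrow> g = 0) \<or>
      (\<forall>g :: ('a, real) c0. \<forall>y\<in>Z. apply_c0 g y = 0)"
    if t0: "0 \<le> t0" and inv: "\<And>t g x. t0 \<le> t \<Longrightarrow> (\<And>y. y \<in> Z \<Longrightarrow> apply_c0 g y = 0) \<Longrightarrow> x \<in> Z \<Longrightarrow>
      apply_c0 (?T t g) x = 0" for t0 Z
  proof -
    have van: "apply_c0 (T t g) x = 0"
      if "t0 \<le> t" "\<And>y. y \<in> Z \<Longrightarrow> apply_c0 g y = 0" "x \<in> Z" for t g x
    proof -
      have "0 \<le> t" using that t0 by simp
      have "apply_c0 (Re_c0 (T t g)) x = 0" "apply_c0 (Im_c0 (T t g)) x = 0"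
        unfolding Re_Im_semigroup[OF \<open>0 \<le> t\<close>] using that by (auto intro!: inv)
      then show ?thesis by (simp add: complex_eq_iff)
    qed
    have "(\<forall>g :: ('a, complex) c0. (\<forall>y\<in>Z. apply_c0 g y = 0) \<longrightarrow> g = 0) \<or>
        (\<forall>g :: ('a, complex) c0. \<forall>y\<in>Z. apply_c0 g y = 0)"
      by (rule persistently_irreducibleD[OF T(2) t0]) (rule van)
    then show ?thesis
    proof (elim disjE)
      assume a: "\<forall>g :: ('a, complex) c0. (\<forall>y\<in>Z. apply_c0 g y = 0) \<longrightarrow> g = 0"
      have "g = 0" if "\<forall>y\<in>Z. apply_c0 g y = 0" for g :: "('a, real) c0"
      proof -
        have "complex_c0 g = 0" using a that by simp
        then show ?thesis by (metis Re_Im_complex_c0(1) complex_c0_simps(1))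
      qed
      then show ?thesis by blast
    next
      assume a: "\<forall>g :: ('a, complex) c0. \<forall>y\<in>Z. apply_c0 g y = 0"
      have "apply_c0 g y = 0" if "y \<in> Z" for g :: "('a, real) c0" and y
        using a[rule_format, OF that, of "complex_c0 g"] by simp
      then show ?thesis by blast
    qed
  qed
qed

end

theorem theorem4p7:
  assumes "locally_compact_space (euclidean :: 'a::t2_space topology)"
  shows
    "(\<forall>T :: real \<Rightarrow> ('a, complex) c0 \<Rightarrow> ('a, complex) c0.
        C0_semigroup T \<and> real_semigroup T \<and> individually_eventually_positive T \<and>
        persistently_irreducible T \<longrightarrow>
        spectrum (generator T) \<noteq> {}) \<and>
     (\<forall>T :: real \<Rightarrow> ('a, real) c0 \<Rightarrow> ('a, real) c0.
        C0_semigroup T \<and> real_semigroup T \<and> individually_eventually_positive T \<and>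
        persistently_irreducible T \<longrightarrow>
        spectrum (complexification (generator T)) \<noteq> {})"
proof (intro conjI allI impI; elim conjE)
  fix T :: "real \<Rightarrow> ('a, complex) c0 \<Rightarrow> ('a, complex) c0"
  assume "C0_semigroup T" "real_semigroup T"
    "individually_eventually_positive T" "persistently_irreducible T"
  then show "spectrum (generator T) \<noteq> {}"
    using irreducible_semigroup.spectrum_complexification_nonempty[OF irreducible_semigroup_real_part]
      complexification_generator assms by metis
next
  fix T :: "real \<Rightarrow> ('a, real) c0 \<Rightarrow> ('a, real) c0"
  assume "C0_semigroup T" "real_semigroup T"
    "individually_eventually_positive T" "persistently_irreducible T"
  then show "spectrum (complexification (generator T)) \<noteq> {}"
    using irreducible_semigroup.spectrum_complexification_nonempty[OF irreducible_semigroup_real] assms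
    by blast
qed

end
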